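(* Let $N$ be a positive integer and $F_1(s),\ldots,F_N(s)$ orthogonal functions satisfying (I) and (II). Then there exist a positive constant $A$ and infinitely many primes $p$ such that $$\Big|\int_0^1\exp\Big(i\sum_{j=1}^N\operatorname{Re}\Big(\overline{y_j}\log F_{j,p}\big(\sigma+i\tfrac{2\pi\theta}{\log p}\big)\Big)\Big)d\theta\Big|\leq\frac{A}{\sqrt{\|\mathbf{y}\|}}\,p^{\sigma/2}$$ for every $\sigma\geq1$ and every $\mathbf{y}=(y_1,\ldots,y_N)\in\mathbb{C}^N\setminus\{\mathbf{0}\}$.
   Context: Write $s=\sigma+it$. Conditions on $F(s)$: (I) $F(s)=\sum_{n=1}^\infty a_F(n)n^{-s}$ is absolutely convergent for $\sigma>1$; (II) $\log F(s)=\sum_p\sum_{k=1}^\infty b_F(p^k)p^{-ks}$ (over primes) is absolutely convergent for $\sigma>1$, with $|b_F(p^k)|\ll p^{k\theta}$ for all primes $p$, $k\geq1$, for some $\theta<\frac12$. For a prime $p$ the local factor $F_p$ is defined by $\log F_p(s)=\sum_{k=1}^\infty b_F(p^k)p^{-ks}$; $F_{j,p}$ is the local factor of $F_j$. $F_1,\ldots,F_N$ are orthogonal if $\sum_{p\leq x}\frac{a_{F_i}(p)\overline{a_{F_j}(p)}}{p}=(m_{i,j}+o(1))\log\log x$ as $x\to\infty$, with $m_{i,i}>0$ and $m_{i,j}=0$ for $i\neq j$. $\|\cdot\|$ is the Euclidean norm.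
   Formalization: The infinitely many primes p may depend on the complex line spanned by y (not on ‖y‖ or σ), with A uniform; one set of primes for all y is impossible when N ≥ 2, since for each p some y cancels the leading term of the exponent. For N = 1 nothing changes. *)

theory Defs
  imports
    "HOL-Analysis.Analysis"
    "HOL-Computational_Algebra.Primes"
    "HOL-Library.Landau_Symbols"
begin

definition has_dirichlet_series :: "(complex \<Rightarrow> complex) \<Rightarrow> (nat \<Rightarrow> complex) \<Rightarrow> bool" where
  "has_dirichlet_series F a \<longleftrightarrow>
     (\<forall>s. Re s > 1 \<longrightarrow>
        (\<lambda>n. norm (a n * of_nat n powr (- s))) summable_on {1..} \<and>
        ((\<lambda>n. a n * of_nat n powr (- s)) has_sum F s) {1..})"

text \<open>
  The branch of the logarithm of \<open>F\<close> is the one given by the series itself, so the identity for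
  \<open>log F\<close> is stated as \<open>F s = exp (\<dots>)\<close>; the principal branch \<open>Ln (F s)\<close> would be wrong
  in general. Only the values of \<open>b\<close> at prime powers \<open>p ^ k\<close> with \<open>k \<ge> 1\<close> matter.
\<close>

definition has_euler_product :: "(complex \<Rightarrow> complex) \<Rightarrow> (nat \<Rightarrow> complex) \<Rightarrow> bool" where
  "has_euler_product F b \<longleftrightarrow>
     (\<forall>s. Re s > 1 \<longrightarrow>
        (\<lambda>(p, k). norm (b (p ^ k) * of_nat p powr (- (of_nat k * s))))
          summable_on ({p. prime p} \<times> {1..}) \<and>
        F s = exp (\<Sum>\<^sub>\<infinity>(p, k)\<in>{p. prime p} \<times> {1..}.
                     b (p ^ k) * of_nat p powr (- (of_nat k * s)))) \<and>
     (\<exists>\<theta><1/2. \<exists>C. \<forall>p k. prime p \<longrightarrow> k \<ge> 1 \<longrightarrow>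
        norm (b (p ^ k)) \<le> C * real p powr (real k * \<theta>))"

definition log_local_factor :: "(nat \<Rightarrow> complex) \<Rightarrow> nat \<Rightarrow> complex \<Rightarrow> complex" where
  "log_local_factor b p s = (\<Sum>\<^sub>\<infinity>k\<in>{1..}. b (p ^ k) * of_nat p powr (- (of_nat k * s)))"

definition orthogonal_coeffs :: "('n \<Rightarrow> nat \<Rightarrow> complex) \<Rightarrow> bool" where
  "orthogonal_coeffs a \<longleftrightarrow>
     (\<exists>m :: 'n \<Rightarrow> 'n \<Rightarrow> real.
        (\<forall>i. m i i > 0) \<and> (\<forall>i j. i \<noteq> j \<longrightarrow> m i j = 0) \<and>
        (\<forall>i j. (\<lambda>x::real. (\<Sum>p | prime p \<and> real p \<le> x. a i p * cnj (a j p) / of_nat p)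
                    - of_real (m i j * ln (ln x)))
               \<in> o[at_top](\<lambda>x. of_real (ln (ln x)))))"

definition local_integral ::
  "('n::finite \<Rightarrow> nat \<Rightarrow> complex) \<Rightarrow> nat \<Rightarrow> real \<Rightarrow> complex ^ 'n \<Rightarrow> complex" where
  "local_integral b p \<sigma> y =
     integral {0..1} (\<lambda>\<theta>::real. exp (\<i> * of_real (\<Sum>j\<in>UNIV.
       Re (cnj (y $ j) * log_local_factor (b j) p (Complex \<sigma> (2 * pi * \<theta> / ln (real p)))))))"

text \<open>
  In the estimate for \<open>local_integral\<close> the primes must be allowed to depend on the complex line
  spanned by \<open>y\<close>. If \<open>b j (p ^ k) = 0\<close> for all \<open>k \<ge> 2\<close> and there are at least two functions, then
  for every prime \<open>p\<close> some \<open>y \<noteq> 0\<close> satisfies \<open>(\<Sum>j. cnj (y $ j) * b j p) = 0\<close>, and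
  \<open>local_integral b p \<sigma> (c *s y) = 1\<close> for all \<open>c\<close>. On the other hand, \<open>p\<close> must not depend on the
  length of \<open>y\<close>: the integral is at most 1 in modulus, so the bound would be trivial for large \<open>p\<close>.
  Hence the line is fixed first, then \<open>p\<close>, and the estimate is claimed on the whole punctured
  line, with one constant for all lines.
\<close>

end

(*
Write the exponent as a real trigonometric series f(t) = Re (sum_k d_k e(-k t)). For large p the
term k = 1 dominates, so with R = |d_1| the derivatives satisfy f'^2 + f''^2 >= R^2 and
f'', f''' = O(R). Splitting 1 = f'^2/(f'^2+R) + R/(f'^2+R), the first part of the integral of
e^(i f) is integrated by parts, and both parts are then O(int R/(f'^2+R)); since
R^2 <= f'^2 + f''^2, another integration by parts with f''/(f'^2+R) = (arctan(f'/sqrt R)/sqrt R)'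
gives O(1/sqrt R). It remains to have |d_1| >= delta |y| p^(-sigma) for infinitely many p.
Comparing the asymptotic expansions of F and exp(log F) as s -> infinity gives a(p) = b(p), so
d_1 = p^(-sigma) sum_j cnj(y_j) a_j(p). By orthogonality
sum_{p<=x} |sum_j cnj(y_j) a_j(p)|^2/p is asymptotically at least a constant times
|y|^2 log log x, which contradicts sum_{p<=x} 1/p = O(log log x) if the lower bound for |d_1|
fails for all but finitely many p and delta is small.
*)

theory Submission
  imports Defs
begin

section \<open>Oscillatory integrals\<close>

text \<open>The model phase R cos (2 pi t) gives the Bessel value J_0(R), of order R^(-1/2):
  stationary points cannot be avoided, and the square root is the true order. With R = |d_1| at
  least delta |y| p^(-sigma), this also accounts for the factor p^(sigma/2). The choice of p must
  depend neither on sigma nor on the length of y. The terms k >= 2 contribute O(|y| p^(2 theta - 2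
  sigma)). Relative to |d_1| this is O(p^(2 theta - sigma)), at most O(p^(2 theta - 1)) for sigma >=
  1. Here theta < 1/2 enters: it is enough that p exceeds a bound fixed in advance. For a(p) = b(p)
  no branch of log F has to be identified: the series L satisfies F = exp L, and exp carries
  expansions at infinity along. For the sum of 1/p an upper bound of the right order suffices,
  because its constant is absorbed into delta.\<close>

text \<open>The weights f1^2/D and R/D with D = f1^2 + R are a smooth replacement for cutting the
  interval at |f1| = sqrt R, the level at which the first and second derivative tests balance. No
  zeros of \<open>f1\<close> have to be counted, and by periodicity every boundary term
  vanishes.\<close>

lemma oscillatory_integral_bound:
  fixes f f1 f2 f3 :: "real \<Rightarrow> real"
  assumes f: "\<And>t. (f has_real_derivative f1 t) (at t)"
    and f1: "\<And>t. (f1 has_real_derivative f2 t) (at t)"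
    and f2: "\<And>t. (f2 has_real_derivative f3 t) (at t)"
    and f3: "continuous_on UNIV f3"
    and per: "f 1 = f 0" "f1 1 = f1 0" "f2 1 = f2 0"
    and R: "R > 0"
    and up2: "\<And>t. \<bar>f2 t\<bar> \<le> C * R"
    and up3: "\<And>t. \<bar>f3 t\<bar> \<le> C * R"
    and low: "\<And>t. R\<^sup>2 \<le> (f1 t)\<^sup>2 + (f2 t)\<^sup>2"
  shows "norm (integral {0..1} (\<lambda>t. exp (\<i> * of_real (f t)))) \<le> (C + 1) * (1 + C * pi / 2) / sqrt R"
proof -
  have "0 \<le> C * R" using up2[of 0] by linarith
  then have C: "C \<ge> 0" using R by (simp add: zero_le_mult_iff)
  define K where "K = (C + 1) * (1 + C * pi / 2)"
  have "1 * 1 \<le> (C + 1) * (1 + C * pi / 2)"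
    using C by (intro mult_mono) auto
  then have K1: "1 \<le> K" by (simp add: K_def)
  have cf: "continuous_on {0..1} f" "continuous_on {0..1} f1" "continuous_on {0..1} f2"
    by (rule DERIV_continuous_on, rule has_field_derivative_at_within, rule f f1 f2)+
  have cf3: "continuous_on {0..1} f3" using f3 continuous_on_subset by blast
  have inte: "(\<lambda>t. exp (\<i> * of_real (f t))) integrable_on {0..1}"
    by (intro integrable_continuous_real continuous_intros cf)
  show ?thesis
  proof (cases "R \<ge> 1")
    \<comment> \<open>For R < 1 the trivial bound 1 is enough, since \<open>K\<close> is at least 1.
      In the other case R >= 1 lets 1/R be absorbed into 1/sqrt R.\<close>
    case False
    have "norm (integral {0..1} (\<lambda>t. exp (\<i> * of_real (f t)))) \<le> integral {0..1} (\<lambda>t::real. 1::real)"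
      by (rule integral_norm_bound_integral[OF inte]) auto
    also have "\<dots> = 1" by simp
    also have "1 \<le> K / sqrt R"
      proof -
      have "sqrt R \<le> 1" using False by simp
      then have "sqrt R \<le> K" using K1 by linarith
      then show ?thesis using R by (simp add: le_divide_eq)
    qed
    finally show ?thesis unfolding K_def .
  next
    case True
    define D where "D t = (f1 t)\<^sup>2 + R" for t
    have D: "D t > 0" for t unfolding D_def using R by (simp add: add_nonneg_pos)
    define e where "e t = exp (\<i> * complex_of_real (f t))" for t
    \<comment> \<open>\<open>g\<close> is chosen so that g e' = i (f1^2/D) e. As g e has equal
      values at both ends, the integral of (f1^2/D) e is, up to a constant factor, that of g'
      e.\<close>
    define g where "g t = f1 t / D t" for t
    define g' where "g' t = f2 t * (R - (f1 t)\<^sup>2) / (D t)\<^sup>2" for t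
    have dg: "(g has_real_derivative g' t) (at t)" for t
    proof -
      have "(g has_real_derivative (f2 t * D t - f1 t * (2 * f1 t * f2 t)) / (D t * D t)) (at t)"
        unfolding g_def using D[of t]
        by (auto intro!: derivative_eq_intros f1 simp: D_def)
      moreover have "f2 t * D t - f1 t * (2 * f1 t * f2 t) = f2 t * (R - (f1 t)\<^sup>2)"
        by (simp add: D_def algebra_simps power2_eq_square)
      ultimately show ?thesis by (simp add: g'_def power2_eq_square)
    qed
    have de: "(e has_vector_derivative (\<i> * of_real (f1 t) * e t)) (at t)" for t
    proof -
      have "((\<lambda>t. \<i> * complex_of_real (f t)) has_vector_derivative \<i> * of_real (f1 t)) (at t)"
        by (intro has_vector_derivative_mult_right has_vector_derivative_of_real f)
      from field_vector_diff_chain_at[OF this DERIV_exp] show ?thesis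
        by (simp add: e_def[abs_def] o_def)
    qed
    have dge: "((\<lambda>t. of_real (g t) * e t) has_vector_derivative
        (of_real (g t) * (\<i> * of_real (f1 t) * e t) + of_real (g' t) * e t)) (at t)" for t
      by (intro has_vector_derivative_mult de has_vector_derivative_of_real dg)
    have "((\<lambda>t. of_real (g t) * (\<i> * of_real (f1 t) * e t) + of_real (g' t) * e t)
       has_integral (of_real (g 1) * e 1 - of_real (g 0) * e 0)) {0..1}"
      by (rule fundamental_theorem_of_calculus[OF _ has_vector_derivative_at_within[OF dge]]) simp
    then have I0: "((\<lambda>t. of_real (g t) * (\<i> * of_real (f1 t) * e t) + of_real (g' t) * e t)
       has_integral 0) {0..1}"
      using per by (simp add: g_def D_def e_def)
    have split: "e t - (- \<i>) * (of_real (g t) * (\<i> * of_real (f1 t) * e t) + of_real (g' t) * e t)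
        = (of_real (R / D t) + \<i> * of_real (g' t)) * e t" for t
    proof -
      have "1 - g t * f1 t = R / D t"
        using D[of t] by (simp add: g_def field_simps) (simp add: D_def power2_eq_square)
      then have eq: "complex_of_real (R / D t) = 1 - of_real (g t) * of_real (f1 t)" by (metis of_real_1 of_real_diff of_real_mult)
      show ?thesis unfolding eq by (simp add: algebra_simps)
    qed
    have Ie: "((\<lambda>t. (of_real (R / D t) + \<i> * of_real (g' t)) * e t) has_integral integral {0..1} e) {0..1}"
      using has_integral_diff[OF integrable_integral[OF inte] has_integral_mult_right[OF I0, of "- \<i>"]]
      unfolding split[symmetric] by (simp add: e_def[abs_def])
    define s where "s = sqrt R"
    have s: "s > 0" "s * s = R" using R by (auto simp: s_def)
    \<comment> \<open>The integral of h' is 0 by periodicity, so that of f2^2/D is minus the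
      integral of f3 times a bounded arctan over s. This is O(R/s) = O(s), since R = s^2.\<close>
    define h where "h t = f2 t * (arctan (f1 t / s) / s)" for t
    have darc: "((\<lambda>t. arctan (f1 t / s) / s) has_real_derivative f2 t / D t) (at t)" for t
    proof -
      have "((\<lambda>t. arctan (f1 t / s) / s) has_real_derivative (f2 t / s) / (1 + (f1 t / s)\<^sup>2) / s) (at t)"
        by (auto intro!: derivative_eq_intros f1 simp: divide_inverse mult_ac)
      moreover have "(f2 t / s) / (1 + (f1 t / s)\<^sup>2) / s = f2 t / D t"
      proof -
        have "(f2 t / s) / (1 + (f1 t / s)\<^sup>2) / s = f2 t / (s * s * (1 + (f1 t / s)\<^sup>2))"
          by (simp add: field_simps)
        also have "s * s * (1 + (f1 t / s)\<^sup>2) = D t"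
          using s R by (simp add: D_def field_simps power2_eq_square)
        finally show ?thesis .
      qed
      ultimately show ?thesis by (simp only:)
    qed
    have dh: "(h has_vector_derivative (f2 t * (f2 t / D t) + f3 t * (arctan (f1 t / s) / s))) (at t)" for t
      unfolding h_def has_real_derivative_iff_has_vector_derivative[symmetric]
      by (rule DERIV_cong[OF DERIV_mult[OF f2 darc]]) simp
    have "((\<lambda>t. f2 t * (f2 t / D t) + f3 t * (arctan (f1 t / s) / s)) has_integral (h 1 - h 0)) {0..1}"
      by (rule fundamental_theorem_of_calculus[OF _ has_vector_derivative_at_within[OF dh]]) simp
    then have H0: "((\<lambda>t. f2 t * (f2 t / D t) + f3 t * (arctan (f1 t / s) / s)) has_integral 0) {0..1}"
      using per by (simp add: h_def)
    have i3: "(\<lambda>t. f3 t * (arctan (f1 t / s) / s)) integrable_on {0..1}"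
      using s by (intro integrable_continuous_real continuous_intros cf cf3) auto
    define J where "J = integral {0..1} (\<lambda>t. f3 t * (arctan (f1 t / s) / s))"
    have HJ: "((\<lambda>t. f2 t * (f2 t / D t)) has_integral (- J)) {0..1}"
      using has_integral_diff[OF H0 integrable_integral[OF i3]] by (simp add: J_def)
    have "norm J \<le> integral {0..1} (\<lambda>t::real. C * R * (pi / 2 / s))"
      unfolding J_def
    proof (rule integral_norm_bound_integral[OF i3])
      fix t :: real
      have "\<bar>arctan (f1 t / s)\<bar> \<le> pi / 2" using arctan_bounded[of "f1 t / s"] by linarith
      then have "\<bar>f3 t\<bar> * (\<bar>arctan (f1 t / s)\<bar> / s) \<le> C * R * (pi / 2 / s)"
        using up3[of t] s C R by (intro mult_mono divide_right_mono) auto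
      then show "norm (f3 t * (arctan (f1 t / s) / s)) \<le> C * R * (pi / 2 / s)"
        using s by (simp add: abs_mult)
    qed auto
    then have J: "\<bar>J\<bar> \<le> C * R * (pi / 2 / s)" by simp
    have pt: "norm ((of_real (R / D t) + \<i> * of_real (g' t)) * e t)
        \<le> (C + 1) * (1 / R + (f2 t * (f2 t / D t)) / R)" for t
    proof -
      have "norm ((of_real (R / D t) + \<i> * of_real (g' t)) * e t) \<le> \<bar>R / D t\<bar> + \<bar>g' t\<bar>"
        unfolding norm_mult e_def norm_exp_i_times mult_1_right
        by (rule norm_triangle_le) (simp add: norm_mult del: of_real_divide)
      also have "\<bar>R / D t\<bar> = R / D t" using R D[of t] by simp
      also have "\<bar>g' t\<bar> \<le> C * R / D t"
      proof -
        have "\<bar>R - (f1 t)\<^sup>2\<bar> \<le> D t" using R by (auto simp: D_def abs_le_iff)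
        then have "\<bar>f2 t\<bar> * \<bar>R - (f1 t)\<^sup>2\<bar> \<le> (C * R) * D t"
          using up2 C R by (intro mult_mono) auto
        then have "\<bar>f2 t\<bar> * \<bar>R - (f1 t)\<^sup>2\<bar> / (D t)\<^sup>2 \<le> (C * R) * D t / (D t)\<^sup>2"
          by (intro divide_right_mono) auto
        then show ?thesis using D[of t] by (simp add: g'_def abs_mult power2_eq_square)
      qed
      also have "R / D t + C * R / D t = (C + 1) * (R / D t)" by (simp add: algebra_simps add_divide_distrib)
      \<comment> \<open>R^2 <= f1^2 + f2^2 <= D + f2^2, divided by D R. The weight R/D is thus
        bounded by a constant plus a multiple of f2^2/D, whose integral is known.\<close>
      also have "R / D t \<le> 1 / R + (f2 t * (f2 t / D t)) / R"
      proof -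
        have "R * R \<le> D t + f2 t * f2 t" using low[of t] R by (simp add: D_def power2_eq_square)
        then have "R * R / (D t * R) \<le> (D t + f2 t * f2 t) / (D t * R)"
          using D[of t] R by (intro divide_right_mono) auto
        then show ?thesis using D[of t] R by (simp add: add_divide_distrib)
      qed
      finally show ?thesis using C by (simp add: mult_left_mono)
    qed
    have HB: "((\<lambda>t. (C + 1) * (1 / R + (f2 t * (f2 t / D t)) / R)) has_integral
        (C + 1) * (1 / R + (- J) / R)) {0..1}"
      using has_integral_const_real[of "1 :: real" 0 1]
      by (intro has_integral_mult_right has_integral_add has_integral_divide HJ) simp
    have "norm (integral {0..1} e) \<le> (C + 1) * (1 / R + (- J) / R)"
      using integral_norm_bound_integral[OF has_integral_integrable[OF Ie] has_integral_integrable[OF HB] pt]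
      unfolding integral_unique[OF Ie] integral_unique[OF HB] .
    also have "\<dots> \<le> (C + 1) * (1 / s + C * (pi / 2 / s))"
    proof (intro mult_left_mono add_mono)
      have "1 \<le> s" using True by (simp add: s_def)
      then have "s * 1 \<le> s * s" by (intro mult_left_mono) auto
      then show "1 / R \<le> 1 / s" using s R by (simp add: frac_le)
      have "- J \<le> C * (pi / 2 / s) * R" using J by (simp add: mult_ac)
      then show "- J / R \<le> C * (pi / 2 / s)" using R by (subst pos_divide_le_eq) auto
    qed (use C in auto)
    also have "\<dots> = K / sqrt R" using s by (simp add: K_def s_def field_simps)
    finally show ?thesis by (simp add: K_def e_def[abs_def])
  qed
qed

section \<open>Power series on the unit circle as phase functions\<close>

text \<open>The operator x d/dx multiplies the n-th coefficient by n and keeps the disc of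
  convergence, so it can be iterated. On x = exp(-2 pi i t) it is d/dt up to a constant. The
  derivative \<open>G\<close> stays anonymous because the chain rule only produces x G.\<close>

lemma powser_euler_operator:
  fixes c :: "nat \<Rightarrow> complex"
  assumes "\<And>x. norm x < K \<Longrightarrow> summable (\<lambda>n. c n * x ^ n)" and "norm x < K"
  shows "summable (\<lambda>n. of_nat n * c n * x ^ n)"
    and "\<exists>G. ((\<lambda>x. \<Sum>n. c n * x ^ n) has_field_derivative G) (at x)
              \<and> x * G = (\<Sum>n. of_nat n * c n * x ^ n)"
proof -
  have S: "summable (\<lambda>n. diffs c n * x ^ n)"
    by (rule termdiff_converges[OF assms(2)]) (use assms(1) in auto)
  have eq: "x * (diffs c n * x ^ n) = of_nat (Suc n) * c (Suc n) * x ^ Suc n" for n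
    by (simp add: diffs_def)
  have "summable (\<lambda>n. of_nat (Suc n) * c (Suc n) * x ^ Suc n)"
    using summable_mult[OF S, of x] unfolding eq .
  then show S': "summable (\<lambda>n. of_nat n * c n * x ^ n)"
    by (subst (asm) summable_Suc_iff)
  obtain L where L: "norm x < L" "L < K" using dense assms(2) by blast
  then have L0: "L > 0" using norm_ge_zero[of x] by linarith
  have "((\<lambda>x. \<Sum>n. c n * x ^ n) has_field_derivative (\<Sum>n. diffs c n * x ^ n)) (at x)"
    by (rule termdiffs_strong[where K = "of_real L"]) (use L L0 assms(1) in auto)
  moreover have "x * (\<Sum>n. diffs c n * x ^ n) = (\<Sum>n. of_nat n * c n * x ^ n)"
    using suminf_split_head[OF S'] suminf_mult[OF S, of x] unfolding eq by simp
  ultimately show "\<exists>G. ((\<lambda>x. \<Sum>n. c n * x ^ n) has_field_derivative G) (at x)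
              \<and> x * G = (\<Sum>n. of_nat n * c n * x ^ n)"
    by blast
qed

text \<open>The factor \<open>u\<close> collects the -2 pi i of each differentiation, so the result
  applies again to the derivative. K > 1 puts the unit circle inside the open disc.\<close>

lemma has_real_derivative_trig_series:
  fixes c :: "nat \<Rightarrow> complex"
  assumes "\<And>x. norm x < K \<Longrightarrow> summable (\<lambda>n. c n * x ^ n)" and "K > 1"
  shows "((\<lambda>t. Re (u * (\<Sum>n. c n * cis (- (2 * pi * t)) ^ n))) has_real_derivative
           Re (u * (- (2 * pi * \<i>)) * (\<Sum>n. of_nat n * c n * cis (- (2 * pi * t)) ^ n))) (at t)"
proof -
  let ?w = "\<lambda>t. cis (- (2 * pi * t))"
  have w: "(?w has_vector_derivative (- (2 * pi * \<i>)) * ?w t) (at t)"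
  proof -
    have "((\<lambda>t. - (2 * pi * \<i>) * complex_of_real t) has_vector_derivative - (2 * pi * \<i>) * of_real 1) (at t)"
      by (intro has_vector_derivative_mult_right has_vector_derivative_of_real DERIV_ident)
    from field_vector_diff_chain_at[OF this DERIV_exp] show ?thesis
      by (simp add: o_def cis_conv_exp mult_ac)
  qed
  have "norm (?w t) < K" using assms(2) by simp
  from powser_euler_operator(2)[OF assms(1) this] obtain G where
    G: "((\<lambda>x. \<Sum>n. c n * x ^ n) has_field_derivative G) (at (?w t))"
       "?w t * G = (\<Sum>n. of_nat n * c n * ?w t ^ n)" by blast
  from field_vector_diff_chain_at[OF w G(1)]
  have "((\<lambda>t. \<Sum>n. c n * ?w t ^ n) has_vector_derivative
           (- (2 * pi * \<i>)) * (\<Sum>n. of_nat n * c n * ?w t ^ n)) (at t)"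
    unfolding G(2)[symmetric] by (simp add: o_def mult_ac)
  then have "((\<lambda>t. u * (\<Sum>n. c n * ?w t ^ n)) has_vector_derivative
           u * ((- (2 * pi * \<i>)) * (\<Sum>n. of_nat n * c n * ?w t ^ n))) (at t)"
    by (rule has_vector_derivative_mult_right)
  from bounded_linear.has_vector_derivative[OF bounded_linear_Re this]
  show ?thesis by (simp add: has_real_derivative_iff_has_vector_derivative mult.assoc)
qed

text \<open>The weight (k+2)^3 keeps the series and its first three derivatives, stripped of powers
  of -2 pi i, within |d 1|/4 of d 1 w. Hence f' and f'' are close to multiples of the imaginary and
  the real part of one number of modulus R, and these cannot both be small. The constant 16 pi^3 is
  (2 pi)^3 times 2, from |P 3| <= 2 R.\<close>

lemma trig_series_integral_bound:
  fixes d :: "nat \<Rightarrow> complex"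
  assumes K: "K > 1" and d: "\<And>x. norm x < K \<Longrightarrow> summable (\<lambda>n. d n * x ^ n)"
    and d0: "d 0 = 0" and d1: "d 1 \<noteq> 0"
    and tail: "summable (\<lambda>k. real (k + 2) ^ 3 * norm (d (k + 2)))"
       "(\<Sum>k. real (k + 2) ^ 3 * norm (d (k + 2))) \<le> norm (d 1) / 4"
  shows "norm (integral {0..1} (\<lambda>t. exp (\<i> * of_real (Re (\<Sum>k. d k * cis (- (2 * pi * t)) ^ k)))))
    \<le> (16 * pi ^ 3 + 1) * (1 + 16 * pi ^ 3 * pi / 2) / sqrt (norm (d 1))"
proof -
  define R where "R = norm (d 1)"
  have R: "R > 0" using d1 by (simp add: R_def)
  define w where "w t = cis (- (2 * pi * t))" for t
  have w: "norm (w t) = 1" for t by (simp add: w_def)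
  define dk where "dk m n = of_nat n ^ m * d n" for m n
  define P where "P m t = (\<Sum>n. dk m n * w t ^ n)" for m t
  have sum: "norm x < K \<Longrightarrow> summable (\<lambda>n. dk m n * x ^ n)" for m x
  proof (induction m arbitrary: x)
    case 0
    then show ?case using d by (simp add: dk_def)
  next
    case (Suc m)
    show ?case using powser_euler_operator(1)[OF Suc.IH Suc.prems]
      by (simp add: dk_def mult.assoc)
  qed
  have deriv: "((\<lambda>t. Re (u * P m t)) has_real_derivative
       Re (u * (- (2 * pi * \<i>)) * P (Suc m) t)) (at t)" for u m t
    using has_real_derivative_trig_series[where c = "dk m" and K = K and u = u and t = t] sum K
    by (simp add: P_def w_def dk_def mult.assoc)
  have P1: "norm (P m t - d 1 * w t) \<le> R / 4" if "m \<le> 3" for m t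
  proof -
    have sm: "summable (\<lambda>n. dk m n * w t ^ n)" using sum w K by simp
    have "P m t = (\<Sum>n. dk m (n + 2) * w t ^ (n + 2)) + (\<Sum>n<2. dk m n * w t ^ n)"
      unfolding P_def by (rule suminf_split_initial_segment[OF sm])
    \<comment> \<open>Since 0^0 = 1, for m = 0 the term n = 0 disappears only because d 0 =
      0.\<close>
    also have "(\<Sum>n<2. dk m n * w t ^ n) = d 1 * w t"
      using d0 by (simp add: dk_def numeral_2_eq_2)
    finally have "P m t - d 1 * w t = (\<Sum>n. dk m (n + 2) * w t ^ (n + 2))" by simp
    also have "norm \<dots> \<le> (\<Sum>k. real (k + 2) ^ 3 * norm (d (k + 2)))"
    proof (rule norm_suminf_le[OF _ tail(1)])
      fix n
      have "real (n + 2) ^ m \<le> real (n + 2) ^ 3" using that by (intro power_increasing) auto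
      then show "norm (dk m (n + 2) * w t ^ (n + 2)) \<le> real (n + 2) ^ 3 * norm (d (n + 2))"
        unfolding dk_def norm_mult norm_power norm_of_nat w power_one mult_1_right
        by (rule mult_right_mono) simp
    qed
    finally show ?thesis using tail(2) by (simp add: R_def)
  qed
  have P2: "norm (P m t) \<le> 2 * R" if "m \<le> 3" for m t
  proof -
    have "norm (P m t) \<le> norm (P m t - d 1 * w t) + norm (d 1 * w t)"
      using norm_triangle_ineq[of "P m t - d 1 * w t" "d 1 * w t"] by simp
    moreover have "norm (d 1 * w t) = R" by (simp add: norm_mult w R_def)
    ultimately show ?thesis using P1[OF that, of t] R by linarith
  qed
  let ?v = "- (2 * pi * \<i>)"
  have w01: "w 1 = w 0" by (simp add: w_def complex_eq_iff)
  have vn: "norm (?v) = 2 * pi" by (simp add: norm_mult)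
  have "norm (integral {0..1} (\<lambda>t. exp (\<i> * of_real (Re (1 * P 0 t)))))
     \<le> (16 * pi ^ 3 + 1) * (1 + 16 * pi ^ 3 * pi / 2) / sqrt R"
  proof (rule oscillatory_integral_bound)
    show "((\<lambda>t. Re (1 * P 0 t)) has_real_derivative Re (1 * ?v * P 1 t)) (at t)" for t
      using deriv[of 1 0 t] by simp
    show "((\<lambda>t. Re (1 * ?v * P 1 t)) has_real_derivative Re (1 * ?v * ?v * P 2 t)) (at t)" for t
      using deriv[of "1 * ?v" 1 t] by (simp only: numeral_2_eq_2 One_nat_def)
    show "((\<lambda>t. Re (1 * ?v * ?v * P 2 t)) has_real_derivative Re (1 * ?v * ?v * ?v * P 3 t)) (at t)" for t
      using deriv[of "1 * ?v * ?v" 2 t] by (simp only: numeral_3_eq_3 numeral_2_eq_2)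
    show "continuous_on UNIV (\<lambda>t. Re (1 * ?v * ?v * ?v * P 3 t))"
      by (rule DERIV_continuous_on[OF has_field_derivative_at_within[OF deriv]])
    show "\<bar>Re (1 * ?v * ?v * P 2 t)\<bar> \<le> 16 * pi ^ 3 * R" for t
    proof -
      have "\<bar>Re (1 * ?v * ?v * P 2 t)\<bar> \<le> norm (1 * ?v * ?v * P 2 t)" by (rule abs_Re_le_cmod)
      also have "\<dots> = (2 * pi) * (2 * pi) * norm (P 2 t)" by (simp only: norm_mult[of _ "P 2 t"] norm_mult[of _ ?v] vn) simp
      also have "\<dots> \<le> (2 * pi) * (2 * pi) * (2 * R)" using P2[of 2 t] by (intro mult_left_mono) auto
      also have "\<dots> = 8 * (pi ^ 2 * 1) * R" by (simp add: power2_eq_square)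
      \<comment> \<open>8 pi^2 is enlarged to 16 pi^3 so that one constant serves the second and the
        third derivative.\<close>
      also have "\<dots> \<le> 16 * (pi ^ 2 * pi) * R" using R pi_ge_two by (intro mult_mono) auto
      finally show ?thesis by (simp add: power2_eq_square power3_eq_cube)
    qed
    show "\<bar>Re (1 * ?v * ?v * ?v * P 3 t)\<bar> \<le> 16 * pi ^ 3 * R" for t
    proof -
      have "\<bar>Re (1 * ?v * ?v * ?v * P 3 t)\<bar> \<le> norm (1 * ?v * ?v * ?v * P 3 t)" by (rule abs_Re_le_cmod)
      also have "\<dots> = (2 * pi) * (2 * pi) * (2 * pi) * norm (P 3 t)" by (simp only: norm_mult[of _ "P 3 t"] norm_mult[of _ ?v] vn) simp
      also have "\<dots> \<le> (2 * pi) * (2 * pi) * (2 * pi) * (2 * R)" using P2[of 3 t] by (intro mult_left_mono) auto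
      finally show ?thesis by (simp add: power3_eq_cube)
    qed
    show "R\<^sup>2 \<le> (Re (1 * ?v * P 1 t))\<^sup>2 + (Re (1 * ?v * ?v * P 2 t))\<^sup>2" for t
    proof -
      define z where "z = d 1 * w t"
      have z: "(Re z)\<^sup>2 + (Im z)\<^sup>2 = R\<^sup>2"
        unfolding cmod_power2[symmetric] by (simp add: z_def norm_mult w R_def)
      \<comment> \<open>This is b^2 <= 2 a^2 + 2 (a - b)^2, scaled by 4. Used for both parts of z it
        makes the sum of the two 4 a^2 at least (4 R^2 - R^2)/2, which exceeds R^2.\<close>
      have half: "4 * b\<^sup>2 - 4 * (R / 4)\<^sup>2 * 2 \<le> 2 * (4 * a\<^sup>2)" if "\<bar>a - b\<bar> \<le> R / 4" for a b :: real
      proof -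
        have "(a - b)\<^sup>2 \<le> (R / 4)\<^sup>2" using that R by (intro abs_le_square_iff[THEN iffD1]) auto
        moreover have "0 \<le> (b - 2 * (b - a))\<^sup>2" by simp
        ultimately show ?thesis by (simp add: power2_eq_square algebra_simps)
      qed
      have 1: "\<bar>Im (P 1 t) - Im z\<bar> \<le> R / 4"
        using abs_Im_le_cmod[of "P 1 t - z"] P1[of 1 t] by (simp add: z_def)
      have 2: "\<bar>Re (P 2 t) - Re z\<bar> \<le> R / 4"
        using abs_Re_le_cmod[of "P 2 t - z"] P1[of 2 t] by (simp add: z_def)
      have "4 * (Im (P 1 t))\<^sup>2 \<le> (2 * pi) ^ 2 * (Im (P 1 t))\<^sup>2"
        using pi_ge_two power_mono[of 2 "2 * pi" 2] by (intro mult_right_mono) auto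
      moreover have "4 * (Re (P 2 t))\<^sup>2 \<le> (4 * pi\<^sup>2) ^ 2 * (Re (P 2 t))\<^sup>2"
      proof (intro mult_right_mono)
        have "1 \<le> pi\<^sup>2" using pi_ge_two by (intro one_le_power) linarith
        then have "2 ^ 2 \<le> (4 * pi\<^sup>2) ^ 2" by (intro power_mono) linarith+
        then show "4 \<le> (4 * pi\<^sup>2) ^ 2" by simp
      qed auto
      moreover have "Re (1 * ?v * P 1 t) = 2 * pi * Im (P 1 t)" by simp
      moreover have "Re (1 * ?v * ?v * P 2 t) = - (4 * pi\<^sup>2 * Re (P 2 t))" by (simp add: power2_eq_square)
      ultimately have "4 * (Im (P 1 t))\<^sup>2 + 4 * (Re (P 2 t))\<^sup>2
          \<le> (Re (1 * ?v * P 1 t))\<^sup>2 + (Re (1 * ?v * ?v * P 2 t))\<^sup>2"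
        by (simp only: power_mult_distrib power2_minus)
      moreover have "R\<^sup>2 = (R / 4)\<^sup>2 * 16" by (simp add: power2_eq_square)
      moreover have "0 \<le> (R / 4)\<^sup>2" by simp
      ultimately show ?thesis using half[OF 1] half[OF 2] z by linarith
    qed
  qed (use R w01 in \<open>simp_all add: P_def\<close>)
  then show ?thesis by (simp add: P_def dk_def w_def R_def)
qed

section \<open>The sum of the reciprocals of the primes\<close>

text \<open>By the mean value theorem for z^(1-s), each term is at most a difference of consecutive
  values over s - 1, and these telescope. \<open>A\<close> is an arbitrary finite set because it
  will consist of squarefree numbers rather than an initial segment.\<close>

lemma sum_powr_le:
  fixes s :: real
  assumes "s > 1" and "finite A" and "A \<subseteq> {1..}"
  shows "(\<Sum>n\<in>A. real n powr (- s)) \<le> 1 + 1 / (s - 1)"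
proof -
  have step: "real (Suc n) powr (- s) \<le> (real n powr (1 - s) - real (Suc n) powr (1 - s)) / (s - 1)"
    if "n \<ge> 1" for n
  proof -
    have "\<exists>z>real n. z < real (Suc n) \<and> real (Suc n) powr (1 - s) - real n powr (1 - s)
          = (real (Suc n) - real n) * ((1 - s) * z powr (1 - s - 1))"
      by (rule MVT2) (use that in \<open>auto intro!: derivative_eq_intros\<close>)
    then obtain z where z: "real n < z" "z < real (Suc n)"
      "real (Suc n) powr (1 - s) - real n powr (1 - s) = (1 - s) * z powr (- s)" by auto
    have "real (Suc n) powr (- s) \<le> z powr (- s)"
      using z that assms(1) by (intro powr_mono2') auto
    also have "z powr (- s) = (real n powr (1 - s) - real (Suc n) powr (1 - s)) / (s - 1)"
      using z(3) assms(1) by (simp add: field_simps)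
    finally show ?thesis .
  qed
  have part: "(\<Sum>n=1..Suc m. real n powr (- s)) \<le> 1 + (1 - real (Suc m) powr (1 - s)) / (s - 1)" for m
  proof (induction m)
    case 0
    show ?case by simp
  next
    case (Suc m)
    have "(\<Sum>n=1..Suc (Suc m). real n powr (- s))
        = (\<Sum>n=1..Suc m. real n powr (- s)) + real (Suc (Suc m)) powr (- s)" by simp
    also have "\<dots> \<le> (1 + (1 - real (Suc m) powr (1 - s)) / (s - 1))
         + (real (Suc m) powr (1 - s) - real (Suc (Suc m)) powr (1 - s)) / (s - 1)"
      by (intro add_mono Suc step) simp
    also have "\<dots> = 1 + (1 - real (Suc (Suc m)) powr (1 - s)) / (s - 1)"
      by (simp add: diff_divide_distrib)
    finally show ?case .
  qed
  obtain m where m: "A \<subseteq> {1..Suc m}"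
  proof -
    obtain k where "\<forall>n\<in>A. n \<le> k" using assms(2) finite_nat_set_iff_bounded_le by blast
    then have "A \<subseteq> {1..Suc k}" using assms(3) by fastforce
    then show ?thesis by (rule that)
  qed
  have "(\<Sum>n\<in>A. real n powr (- s)) \<le> (\<Sum>n=1..Suc m. real n powr (- s))"
    by (rule sum_mono2) (use m in auto)
  also have "\<dots> \<le> 1 + (1 - real (Suc m) powr (1 - s)) / (s - 1)" by (rule part)
  also have "\<dots> \<le> 1 + 1 / (s - 1)"
    using assms(1) by (intro add_left_mono divide_right_mono) auto
  finally show ?thesis .
qed

text \<open>The set is recovered from its product as the set of prime divisors.\<close>

lemma inj_on_prod_primes: "inj_on (\<lambda>A. \<Prod>A) {A. finite A \<and> (\<forall>p\<in>A. prime (p :: nat))}"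
proof (rule inj_on_inverseI)
  fix A :: "nat set"
  assume "A \<in> {A. finite A \<and> (\<forall>p\<in>A. prime p)}"
  then have A: "finite A" "\<And>p. p \<in> A \<Longrightarrow> prime p" by auto
  then have "\<And>q. prime q \<Longrightarrow> q dvd \<Prod>A \<longleftrightarrow> q \<in> A"
    by (metis dvd_prod_eqI prime_dvd_prod_iff primes_dvd_imp_eq id_apply dvd_prodI)
  then show "{q. prime q \<and> q dvd \<Prod>A} = A" using A by blast
qed

text \<open>Multiplied out, the product is a sum of n^(-s) over distinct squarefree n. Taking 1 +
  p^(-s) instead of the full Euler factor keeps the expansion finite.\<close>

lemma prod_one_plus_primes_le:
  fixes s :: real
  assumes "s > 1" and "finite P" and P: "\<And>p. p \<in> P \<Longrightarrow> prime (p :: nat)"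
  shows "(\<Prod>p\<in>P. 1 + real p powr (- s)) \<le> 1 + 1 / (s - 1)"
proof -
  have fin: "finite A" if "A \<in> Pow P" for A using that assms(2) finite_subset by auto
  have "(\<Prod>p\<in>P. 1 + real p powr (- s)) = (\<Sum>A\<in>Pow P. \<Prod>p\<in>A. real p powr (- s))"
    using prod_add[OF assms(2), of "\<lambda>p. real p powr (- s)" "\<lambda>_. 1"] by (simp add: add.commute)
  also have "\<dots> = (\<Sum>A\<in>Pow P. real (\<Prod>A) powr (- s))"
    by (intro sum.cong refl) (simp add: prod_powr_distrib)
  also have "\<dots> = (\<Sum>n\<in>(\<lambda>A. \<Prod>A) ` Pow P. real n powr (- s))"
  proof (subst sum.reindex)
    show "inj_on (\<lambda>A. \<Prod>A) (Pow P)"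
      by (rule inj_on_subset[OF inj_on_prod_primes]) (use fin P in auto)
  qed simp
  also have "\<dots> \<le> 1 + 1 / (s - 1)"
  proof (rule sum_powr_le[OF assms(1)])
    show "finite ((\<lambda>A. \<Prod>A) ` Pow P)" using assms(2) by simp
    have "\<Prod>A \<ge> 1" if "A \<in> Pow P" for A
      using that P prime_ge_1_nat by (intro prod_ge_1) auto
    then show "(\<lambda>A. \<Prod>A) ` Pow P \<subseteq> {1..}" by auto
  qed
  finally show ?thesis .
qed

lemma sum_inverse_primes_le:
  assumes x: "x \<ge> exp 1"
  shows "(\<Sum>p | prime p \<and> real p \<le> x. 1 / real p) \<le> 2 * exp 1 * (ln 2 + ln (ln x))"
proof -
  define P where "P = {p. prime p \<and> real p \<le> x}"
  have "P \<subseteq> {..nat \<lfloor>x\<rfloor>}" by (auto simp: P_def le_nat_floor)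
  then have fin: "finite P" using finite_subset by blast
  have x0: "x > 0" using x exp_gt_zero[of 1] by (meson less_le_trans)
  have lnx: "ln x \<ge> 1" using x x0 by (metis ln_exp ln_le_cancel_iff exp_gt_zero)
  \<comment> \<open>Rankin's trick: with this s, 1/p <= e p^(-s) for all p <= x, while 1/(s - 1) =
    ln x.\<close>
  define s where "s = 1 + 1 / ln x"
  have s: "s > 1" using lnx by (simp add: s_def)
  have t: "1 / real p \<le> 2 * exp 1 * ln (1 + real p powr (- s))" if "p \<in> P" for p
  proof -
    have p: "prime p" "real p \<le> x" using that by (auto simp: P_def)
    then have p1: "real p \<ge> 1" using prime_ge_1_nat[of p] by simp
    have "real p powr (1 / ln x) \<le> x powr (1 / ln x)" using p p1 lnx by (intro powr_mono2) auto
    also have "\<dots> = exp 1" using x0 lnx by (auto simp: powr_def)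
    finally have "exp 1 * real p powr (- (1 / ln x)) \<ge> 1"
      using p1 by (simp add: powr_minus_divide le_divide_eq)
    then have "1 * (1 / real p) \<le> (exp 1 * real p powr (- (1 / ln x))) * (1 / real p)"
      by (rule mult_right_mono) simp
    then have "1 / real p \<le> (exp 1 * real p powr (- (1 / ln x))) * (1 / real p)" by (simp only: mult_1_left)
    also have "\<dots> = exp 1 * real p powr (- s)"
    proof -
      have "real p powr (- s) = real p powr (- (1 / ln x)) * real p powr (- 1)"
        unfolding powr_add[symmetric] by (rule arg_cong[of _ _ "\<lambda>u. real p powr u"]) (simp add: s_def)
      also have "real p powr (- 1) = 1 / real p" using p1 by (simp add: powr_minus divide_inverse)
      finally show ?thesis by simp
    qed
    also have "real p powr (- s) \<le> 2 * ln (1 + real p powr (- s))"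
    proof -
      \<comment> \<open>The factor 2 pays for ln (1 + y) >= y/2 on the unit interval.\<close>
      define y where "y = real p powr (- s)"
      have y: "0 \<le> y" "y \<le> 1"
        using p1 s powr_mono[of "-s" 0 "real p"] by (auto simp: y_def)
      have "1 - 1 / (1 + y) \<le> ln (1 + y)"
        using ln_le_minus_one[of "1 / (1 + y)"] y by (simp add: ln_div)
      moreover have "y / 2 \<le> 1 - 1 / (1 + y)"
        using y mult_mono[of y 1 y y] by (simp add: field_simps)
      ultimately show ?thesis unfolding y_def[symmetric] by linarith
    qed
    finally show ?thesis by simp
  qed
  have "(\<Sum>p\<in>P. 1 / real p) \<le> (\<Sum>p\<in>P. 2 * exp 1 * ln (1 + real p powr (- s)))"
    by (rule sum_mono[OF t])
  also have "\<dots> = 2 * exp 1 * ln (\<Prod>p\<in>P. 1 + real p powr (- s))"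
    using fin by (subst ln_prod) (auto simp: sum_distrib_left add_pos_nonneg add_nonneg_eq_0_iff)
  also have "\<dots> \<le> 2 * exp 1 * ln (2 * ln x)"
  proof (intro mult_left_mono)
    have "(\<Prod>p\<in>P. 1 + real p powr (- s)) \<le> 1 + 1 / (s - 1)"
      by (rule prod_one_plus_primes_le[OF s fin]) (simp add: P_def)
    also have "\<dots> \<le> 2 * ln x" using lnx by (simp add: s_def)
    finally have "(\<Prod>p\<in>P. 1 + real p powr (- s)) \<le> 2 * ln x" .
    moreover have "0 < (\<Prod>p\<in>P. 1 + real p powr (- s))"
      by (intro prod_pos) (simp add: add_pos_nonneg)
    ultimately show "ln (\<Prod>p\<in>P. 1 + real p powr (- s)) \<le> ln (2 * ln x)" by simp
  qed simp
  also have "ln (2 * ln x) = ln 2 + ln (ln x)" using lnx by (intro ln_mult_pos) auto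
  finally show ?thesis by (simp add: P_def)
qed

section \<open>Dirichlet coefficients at primes\<close>

text \<open>Real s is enough: coefficients will be read off from the decay along the real
  axis.\<close>

abbreviation npow :: "nat \<Rightarrow> real \<Rightarrow> complex" where
  "npow n s \<equiv> of_real (real n powr (- s))"

text \<open>
  The sum starts at 2: series with this property have no constant term, which is what makes
  products lose their coefficient at \<open>p\<close>.
\<close>

definition has_prime_coeff :: "nat \<Rightarrow> (real \<Rightarrow> complex) \<Rightarrow> complex \<Rightarrow> bool" where
  "has_prime_coeff p f \<beta> \<longleftrightarrow>
     (\<exists>c. c p = \<beta> \<and> (\<lambda>s. f s - (\<Sum>n\<in>{2..p}. c n * npow n s)) \<in> O(npow (p + 1)))"

lemma npow_bigo:
  assumes "1 \<le> m" "m \<le> n"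
  shows "npow n \<in> O(npow m)"
proof (rule bigoI[where c = 1])
  have "real n powr (- s) \<le> real m powr (- s)" if "s \<ge> 0" for s
    using that assms by (intro powr_mono2') auto
  then show "\<forall>\<^sub>F s in at_top. norm (npow n s) \<le> 1 * norm (npow m s)"
    by (auto intro!: eventually_mono[OF eventually_ge_at_top[of 0]])
qed

lemma npow_bigo_1: "1 \<le> n \<Longrightarrow> npow n \<in> O(\<lambda>_. 1)"
  using npow_bigo[of 1 n] by simp

lemma has_prime_coeff_bigo:
  assumes "f \<in> O(npow (p + 1))"
  shows "has_prime_coeff p f 0"
  unfolding has_prime_coeff_def by (rule exI[of _ "\<lambda>_. 0"]) (use assms in simp)

lemma has_prime_coeff_add:
  assumes "has_prime_coeff p f \<beta>" "has_prime_coeff p g \<gamma>"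
  shows "has_prime_coeff p (\<lambda>s. f s + g s) (\<beta> + \<gamma>)"
proof -
  obtain c d where "c p = \<beta>" "d p = \<gamma>"
    "(\<lambda>s. f s - (\<Sum>n\<in>{2..p}. c n * npow n s)) \<in> O(npow (p + 1))"
    "(\<lambda>s. g s - (\<Sum>n\<in>{2..p}. d n * npow n s)) \<in> O(npow (p + 1))"
    using assms unfolding has_prime_coeff_def by blast
  moreover from sum_in_bigo(1)[OF this(3,4)]
  have "(\<lambda>s. f s + g s - (\<Sum>n\<in>{2..p}. (c n + d n) * npow n s)) \<in> O(npow (p + 1))"
    by (simp add: algebra_simps sum.distrib)
  ultimately show ?thesis
    unfolding has_prime_coeff_def by (intro exI[of _ "\<lambda>n. c n + d n"]) simp
qed

lemma has_prime_coeff_cmult: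
  assumes "has_prime_coeff p f \<beta>"
  shows "has_prime_coeff p (\<lambda>s. k * f s) (k * \<beta>)"
proof -
  obtain c where c: "c p = \<beta>"
    "(\<lambda>s. f s - (\<Sum>n\<in>{2..p}. c n * npow n s)) \<in> O(npow (p + 1))"
    using assms unfolding has_prime_coeff_def by blast
  have "(\<lambda>s. k * (f s - (\<Sum>n\<in>{2..p}. c n * npow n s))) \<in> O(\<lambda>s. npow (p + 1) s)"
    by (cases "k = 0") (use c(2) in auto)
  then have "(\<lambda>s. k * f s - (\<Sum>n\<in>{2..p}. k * c n * npow n s)) \<in> O(npow (p + 1))"
    by (simp add: algebra_simps sum_distrib_left)
  then show ?thesis
    unfolding has_prime_coeff_def by (intro exI[of _ "\<lambda>n. k * c n"]) (simp add: c(1))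
qed

lemma has_prime_coeff_sum:
  assumes "finite A" "\<And>i. i \<in> A \<Longrightarrow> has_prime_coeff p (f i) (\<beta> i)"
  shows "has_prime_coeff p (\<lambda>s. \<Sum>i\<in>A. f i s) (\<Sum>i\<in>A. \<beta> i)"
  using assms
proof (induction A rule: finite_induct)
  case empty
  then show ?case by (simp add: has_prime_coeff_bigo)
next
  case (insert i A)
  then show ?case using has_prime_coeff_add[of p "f i" "\<beta> i"] by simp
qed

lemma has_prime_coeff_npow:
  assumes "2 \<le> n"
  shows "has_prime_coeff p (npow n) (if n = p then 1 else 0)"
proof (cases "n \<le> p")
  case True
  have "(\<Sum>m\<in>{2..p}. (if m = n then 1 else 0) * npow m s) = npow n s" for s
  proof -
    have "(\<Sum>m\<in>{2..p}. (if m = n then 1 else 0) * npow m s) = (\<Sum>m\<in>{2..p}. if m = n then npow m s else 0)"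
      by (intro sum.cong) auto
    also have "\<dots> = npow n s" using True assms by (subst sum.delta) auto
    finally show ?thesis .
  qed
  then show ?thesis
    unfolding has_prime_coeff_def by (intro exI[of _ "\<lambda>m. if m = n then 1 else 0"]) auto
next
  case False
  then show ?thesis using has_prime_coeff_bigo[OF npow_bigo, of p n] by auto
qed

text \<open>As the expansion starts at n = 2, the power f^k is O(2^(-k s)). This is what allows the
  exponential series to be truncated.\<close>

lemma has_prime_coeff_imp_bigo_2:
  assumes "has_prime_coeff p f \<beta>" "p \<ge> 2"
  shows "f \<in> O(npow 2)"
proof -
  obtain c where c: "(\<lambda>s. f s - (\<Sum>n\<in>{2..p}. c n * npow n s)) \<in> O(npow (p + 1))"
    using assms unfolding has_prime_coeff_def by blast
  have "(\<lambda>s. f s - (\<Sum>n\<in>{2..p}. c n * npow n s)) \<in> O(npow 2)"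
    by (rule landau_o.big.trans[OF c npow_bigo]) (use assms in auto)
  moreover have "(\<lambda>s. c n * npow n s) \<in> O(npow 2)" if "n \<in> {2..p}" for n
    using npow_bigo[of 2 n] that by (cases "c n = 0") auto
  then have "(\<lambda>s. \<Sum>n\<in>{2..p}. c n * npow n s) \<in> O(npow 2)"
    by (rule big_sum_in_bigo)
  ultimately have "(\<lambda>s. (f s - (\<Sum>n\<in>{2..p}. c n * npow n s)) + (\<Sum>n\<in>{2..p}. c n * npow n s)) \<in> O(npow 2)"
    by (rule sum_in_bigo(1))
  then show ?thesis by simp
qed

text \<open>
  A prime is not a product of two integers \<open>\<ge> 2\<close>, so it does not occur in a product of two
  Dirichlet series without constant term.
\<close>

lemma has_prime_coeff_mult:
  assumes p: "prime p" and f: "has_prime_coeff p f \<beta>" and g: "has_prime_coeff p g \<gamma>"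
  shows "has_prime_coeff p (\<lambda>s. f s * g s) 0"
proof -
  have p2: "p \<ge> 2" using p prime_ge_2_nat by blast
  obtain c d where cd:
    "(\<lambda>s. f s - (\<Sum>n\<in>{2..p}. c n * npow n s)) \<in> O(npow (p + 1))"
    "(\<lambda>s. g s - (\<Sum>n\<in>{2..p}. d n * npow n s)) \<in> O(npow (p + 1))"
    using f g unfolding has_prime_coeff_def by blast
  define u where "u s = (\<Sum>n\<in>{2..p}. c n * npow n s)" for s
  define v where "v s = (\<Sum>n\<in>{2..p}. d n * npow n s)" for s
  have uv: "has_prime_coeff p (\<lambda>s. u s * v s) 0"
  proof -
    have "has_prime_coeff p (\<lambda>s. \<Sum>(n, m)\<in>{2..p} \<times> {2..p}. (c n * d m) * npow (n * m) s)
        (\<Sum>(n, m)\<in>{2..p} \<times> {2..p}. 0)"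
    proof (rule has_prime_coeff_sum, safe)
      fix n m
      assume nm: "n \<in> {2..p}" "m \<in> {2..p}"
      have "n * m \<noteq> p" using p nm prime_product[of n m] by auto
      moreover have "2 * 1 \<le> n * m" using nm by (intro mult_le_mono) auto
      ultimately have "has_prime_coeff p (npow (n * m)) 0"
        using has_prime_coeff_npow[of "n * m" p] by simp
      from has_prime_coeff_cmult[OF this, of "c n * d m"]
      show "has_prime_coeff p (\<lambda>s. (c n * d m) * npow (n * m) s) 0" by simp
    qed simp
    moreover have "(\<Sum>(n, m)\<in>{2..p} \<times> {2..p}. (c n * d m) * npow (n * m) s) = u s * v s" for s
      unfolding u_def v_def sum_product sum.cartesian_product
      by (intro sum.cong) (auto simp: powr_mult)
    ultimately show ?thesis by simp
  qed
  have npow1: "npow 2 \<in> O(\<lambda>_. 1)" by (rule npow_bigo_1) simp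
  have f1: "f \<in> O(\<lambda>_. 1)" by (rule landau_o.big.trans[OF has_prime_coeff_imp_bigo_2[OF f p2] npow1])
  have g1: "g \<in> O(\<lambda>_. 1)" by (rule landau_o.big.trans[OF has_prime_coeff_imp_bigo_2[OF g p2] npow1])
  have "(\<lambda>s. f s - (f s - u s)) \<in> O(\<lambda>_. 1)"
    by (rule sum_in_bigo(2)[OF f1])
       (use landau_o.big.trans[OF cd(1) npow_bigo_1] in \<open>simp add: u_def\<close>)
  then have u1: "u \<in> O(\<lambda>_. 1)" by simp
  \<comment> \<open>f g - u v = (f - u) g + u (g - v): each term is a bounded factor times
    O((p+1)^(-s)).\<close>
  have "(\<lambda>s. (f s - u s) * g s) \<in> O(\<lambda>s. npow (p + 1) s * 1)"
    by (rule landau_o.big.mult) (use cd(1) g1 in \<open>simp_all add: u_def\<close>)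
  moreover have "(\<lambda>s. u s * (g s - v s)) \<in> O(\<lambda>s. 1 * npow (p + 1) s)"
    by (rule landau_o.big.mult) (use cd(2) u1 in \<open>simp_all add: v_def\<close>)
  ultimately have "(\<lambda>s. (f s - u s) * g s + u s * (g s - v s)) \<in> O(npow (p + 1))"
    using sum_in_bigo(1) by (simp only: mult_1_left mult_1_right) blast
  from has_prime_coeff_add[OF uv has_prime_coeff_bigo[OF this]]
  show ?thesis by (simp add: algebra_simps)
qed

text \<open>Higher powers of f are products and have coefficient 0 at p, so only k = 1 contributes.
  Cutting at k = p is safe: the remainder is O(2^(-(p+1) s)) and 2^(p+1) >= p + 1. The 1 is
  subtracted because an expansion from n = 2 on has no room for a constant.\<close>

lemma has_prime_coeff_exp:
  assumes p: "prime p" and f: "has_prime_coeff p f \<beta>"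
  shows "has_prime_coeff p (\<lambda>s. exp (f s) - 1) \<beta>"
proof -
  have p2: "p \<ge> 2" using p prime_ge_2_nat by blast
  have pow: "has_prime_coeff p (\<lambda>s. f s ^ k) (if k = 1 then \<beta> else 0)" if "k \<ge> 1" for k
    using that
  proof (induction k rule: dec_induct)
    case base
    then show ?case using f by simp
  next
    case (step k)
    then show ?case using has_prime_coeff_mult[OF p f step.IH] by simp
  qed
  have "has_prime_coeff p (\<lambda>s. \<Sum>k\<in>{1..p}. (1 / fact k) * f s ^ k)
      (\<Sum>k\<in>{1..p}. (1 / fact k) * (if k = 1 then \<beta> else 0))"
    by (intro has_prime_coeff_sum has_prime_coeff_cmult pow) auto
  moreover have "(\<Sum>k\<in>{1..p}. (1 / fact k) * (if k = 1 then \<beta> else 0))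
      = (\<Sum>k\<in>{1..p}. if k = 1 then \<beta> else 0)"
    by (intro sum.cong) auto
  moreover have "\<dots> = \<beta>" using p2 by (subst sum.delta) auto
  ultimately have main: "has_prime_coeff p (\<lambda>s. \<Sum>k\<in>{1..p}. (1 / fact k) * f s ^ k) \<beta>" by simp
  have f2: "f \<in> O(npow 2)" by (rule has_prime_coeff_imp_bigo_2[OF f p2])
  obtain B where B: "\<forall>\<^sub>F s in at_top. norm (f s) \<le> B * norm (npow 2 s)"
    using landau_o.bigE[OF f2] by blast
  have "(\<lambda>s. exp (f s) - (\<Sum>k\<le>p. f s ^ k / fact k)) \<in> O(\<lambda>s. f s ^ Suc p)"
  \<comment> \<open>The Taylor remainder carries exp |Re f|, and eventually |f| <= |B| 2^(-s) <=
    |B|.\<close>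
  proof (rule bigoI[where c = "exp \<bar>B\<bar> / fact p"])
    show "\<forall>\<^sub>F s in at_top. norm (exp (f s) - (\<Sum>k\<le>p. f s ^ k / fact k))
        \<le> exp \<bar>B\<bar> / fact p * norm (f s ^ Suc p)"
      using B eventually_ge_at_top[of 0]
    proof eventually_elim
      case (elim s)
      have "norm (npow 2 s) \<le> 1" using elim(2) powr_mono[of "-s" 0 2] by simp
      then have "\<bar>B\<bar> * norm (npow 2 s) \<le> \<bar>B\<bar>" by (simp add: mult_left_le)
      moreover have "B * norm (npow 2 s) \<le> \<bar>B\<bar> * norm (npow 2 s)" by (intro mult_right_mono) auto
      ultimately have "\<bar>Re (f s)\<bar> \<le> \<bar>B\<bar>" using elim(1) abs_Re_le_cmod[of "f s"] by linarith
      then have "exp \<bar>Re (f s)\<bar> * norm (f s) ^ Suc p / fact p \<le> exp \<bar>B\<bar> * norm (f s) ^ Suc p / fact p"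
        by (intro divide_right_mono mult_right_mono) auto
      then show ?case using Taylor_exp[of "f s" p] by (simp only: norm_power) (simp add: mult_ac)
    qed
  qed
  also have "(\<lambda>s. f s ^ Suc p) \<in> O(\<lambda>s. npow 2 s ^ Suc p)" by (rule landau_o.big_power[OF f2])
  also have "(\<lambda>s. npow 2 s ^ Suc p) = npow (2 ^ Suc p)"
  proof -
    have "real (2 ^ n) powr (- s) = (real 2 powr (- s)) ^ n" for n s
      by (induction n) (simp_all add: powr_mult)
    then show ?thesis by (simp only: fun_eq_iff of_real_power) blast
  qed
  also have "npow (2 ^ Suc p) \<in> O(npow (p + 1))"
    by (rule npow_bigo) (use less_exp[of "Suc p"] in auto)
  finally have "has_prime_coeff p (\<lambda>s. exp (f s) - (\<Sum>k\<le>p. f s ^ k / fact k)) 0"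
    by (rule has_prime_coeff_bigo)
  from has_prime_coeff_add[OF this main]
  moreover have "(\<Sum>k\<le>p. f s ^ k / fact k) = 1 + (\<Sum>k\<in>{1..p}. (1 / fact k) * f s ^ k)" for s
  proof -
    have "{..p} = insert 0 {1..p}" by auto
    then show ?thesis by simp
  qed
  ultimately show ?thesis by simp
qed

section \<open>Uniqueness of expansions and the equality a(p) = b(p)\<close>

text \<open>Multiply by n^s, the smaller coefficients being 0 already: the larger terms and the
  error tend to 0, and c n is left as the limit.\<close>

lemma dirichlet_polynomial_eq_0:
  assumes bigo: "(\<lambda>s. \<Sum>n\<in>{1..p}. c n * npow n s) \<in> O(npow (p + 1))"
    and "n \<in> {1..p}"
  shows "c n = 0"
  using assms(2)
proof (induction n rule: less_induct)
  case (less n)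
  then have n: "1 \<le> n" "n \<le> p" by auto
  have lim: "((\<lambda>s. of_real (real n powr s) * npow m s) \<longlongrightarrow> 0) at_top" if "n < m" for m
  proof -
    have "((\<lambda>s. (real n / real m) powr s) \<longlongrightarrow> 0) at_top"
    proof -
      have "filterlim (\<lambda>s. s * ln (real n / real m)) at_bot at_top"
        using n that filterlim_tendsto_neg_mult_at_bot[OF tendsto_const _ filterlim_ident, of "ln (real n / real m)"]
        by (simp add: mult.commute)
      from filterlim_compose[OF exp_at_bot this] show ?thesis
        using n that by (simp add: powr_def)
    qed
    moreover have "of_real (real n powr s) * npow m s = of_real ((real n / real m) powr s)" for s
      unfolding of_real_mult[symmetric] by (simp add: powr_divide powr_minus_divide)
    ultimately show ?thesis using tendsto_of_real by fastforce
  qed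
  have eq: "of_real (real n powr s) * (\<Sum>m\<in>{1..p}. c m * npow m s)
      = c n + (\<Sum>m\<in>{n<..p}. c m * (of_real (real n powr s) * npow m s))" for s
  proof -
    have "{1..p} = {1..<n} \<union> insert n {n<..p}" using n by auto
    then have "(\<Sum>m\<in>{1..p}. c m * npow m s)
        = (\<Sum>m\<in>{1..<n}. c m * npow m s) + (\<Sum>m\<in>insert n {n<..p}. c m * npow m s)"
      by (simp only:) (rule sum.union_disjoint, auto)
    moreover have "(\<Sum>m\<in>{1..<n}. c m * npow m s) = 0" using less n by (intro sum.neutral) auto
    ultimately have "(\<Sum>m\<in>{1..p}. c m * npow m s) = c n * npow n s + (\<Sum>m\<in>{n<..p}. c m * npow m s)"
      by simp
    moreover have "of_real (real n powr s) * npow n s = 1"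
      using n unfolding of_real_mult[symmetric] by (simp add: powr_minus)
    ultimately show ?thesis
      by (simp add: algebra_simps sum_distrib_left)
  qed
  have "((\<lambda>s. c n + (\<Sum>m\<in>{n<..p}. c m * (of_real (real n powr s) * npow m s)))
      \<longlongrightarrow> c n + (\<Sum>m\<in>{n<..p}. c m * 0)) at_top"
    by (intro tendsto_intros lim) auto
  then have L1: "((\<lambda>s. of_real (real n powr s) * (\<Sum>m\<in>{1..p}. c m * npow m s)) \<longlongrightarrow> c n) at_top"
    unfolding eq by simp
  have "(\<lambda>s. of_real (real n powr s) * (\<Sum>m\<in>{1..p}. c m * npow m s))
      \<in> O(\<lambda>s. of_real (real n powr s) * npow (p + 1) s)"
    by (rule landau_o.big.mult[OF landau_o.big_refl bigo])
  also have "(\<lambda>s. of_real (real n powr s) * npow (p + 1) s) \<in> o(\<lambda>_. 1)"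
    by (rule smalloI_tendsto) (use lim[of "p + 1"] n in auto)
  finally have small: "(\<lambda>s. of_real (real n powr s) * (\<Sum>m\<in>{1..p}. c m * npow m s)) \<in> o(\<lambda>_. 1)" .
  have "((\<lambda>s. of_real (real n powr s) * (\<Sum>m\<in>{1..p}. c m * npow m s)) \<longlongrightarrow> 0) at_top"
    using smalloD_tendsto[OF small] by simp
  from tendsto_unique[OF _ L1 this] show ?case by simp
qed

text \<open>This serves as uniqueness of the coefficient at p: two functions with a constant
  difference must have equal coefficients. The constant k is treated as the coefficient at n = 1,
  which is not p.\<close>

lemma has_prime_coeff_const:
  assumes "has_prime_coeff p (\<lambda>_. k) \<beta>" "p \<ge> 2"
  shows "\<beta> = 0"
proof -
  obtain c where c: "c p = \<beta>" "(\<lambda>s. k - (\<Sum>n\<in>{2..p}. c n * npow n s)) \<in> O(npow (p + 1))"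
    using assms unfolding has_prime_coeff_def by blast
  have "(\<Sum>n\<in>{1..p}. (if n = 1 then k else - c n) * npow n s) = k - (\<Sum>n\<in>{2..p}. c n * npow n s)" for s
  proof -
    have "{1..p} = insert 1 {2..p}" using assms(2) by auto
    moreover have "(\<Sum>n\<in>{2..p}. (if n = 1 then k else - c n) * npow n s) = (\<Sum>n\<in>{2..p}. - (c n * npow n s))"
      by (intro sum.cong) auto
    ultimately show ?thesis by (simp add: sum_negf)
  qed
  then have "(if p = 1 then k else - c p) = 0"
    using dirichlet_polynomial_eq_0[of "\<lambda>n. if n = 1 then k else - c n" p p] c(2) assms(2) by simp
  then show ?thesis using c(1) assms(2) by simp
qed

text \<open>For s >= 2 and n > p, n^(-s) <= n^(-2) (p+1)^(2-s), so absolute convergence at the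
  single point 2 bounds the whole tail by a multiple of (p+1)^(-s).\<close>

lemma has_prime_coeff_dirichlet_series:
  assumes f: "\<And>s. s \<ge> 2 \<Longrightarrow> ((\<lambda>n. c n * npow n s) has_sum f s) {2..}"
    and abs: "(\<lambda>n. norm (c n) * real n powr (- 2)) summable_on {2..}"
    and p: "p \<ge> 2"
  shows "has_prime_coeff p f (c p)"
proof -
  have abs': "(\<lambda>n. norm (c n) * real n powr (- 2)) summable_on {p<..}"
    by (rule summable_on_subset_banach[OF abs]) (use p in auto)
  define S where "S = infsum (\<lambda>n. norm (c n) * real n powr (- 2)) {p<..}"
  have S: "((\<lambda>n. norm (c n) * real n powr (- 2)) has_sum S) {p<..}"
    unfolding S_def by (rule has_sum_infsum[OF abs'])
  have "(\<lambda>s. f s - (\<Sum>n\<in>{2..p}. c n * npow n s)) \<in> O(npow (p + 1))"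
  proof (rule bigoI[where c = "S * real (p + 1) powr 2"])
    show "\<forall>\<^sub>F s in at_top. norm (f s - (\<Sum>n\<in>{2..p}. c n * npow n s))
        \<le> S * real (p + 1) powr 2 * norm (npow (p + 1) s)"
      using eventually_ge_at_top[of 2]
    proof eventually_elim
      case (elim s)
      have "((\<lambda>n. c n * npow n s) has_sum (f s - (\<Sum>n\<in>{2..p}. c n * npow n s))) ({2..} - {2..p})"
        by (rule has_sum_Diff[OF f[OF elim] has_sum_finite]) auto
      moreover have "{2..} - {2..p} = {p<..}" using p by auto
      ultimately have H: "((\<lambda>n. c n * npow n s) has_sum (f s - (\<Sum>n\<in>{2..p}. c n * npow n s))) {p<..}"
        by simp
      have "norm (f s - (\<Sum>n\<in>{2..p}. c n * npow n s)) \<le> S * real (p + 1) powr (2 - s)"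
      proof (rule norm_infsum_le[OF H has_sum_cmult_left[OF S]])
        fix n
        assume "n \<in> {p<..}"
        then have n: "real (p + 1) \<le> real n" by auto
        have "real n powr (- s) = real n powr (- 2) * real n powr (2 - s)"
          by (simp flip: powr_add)
        also have "real n powr (2 - s) \<le> real (p + 1) powr (2 - s)"
          using elim n by (intro powr_mono2') auto
        finally have "real n powr (- s) \<le> real n powr (- 2) * real (p + 1) powr (2 - s)"
          by (simp add: mult_left_mono)
        then have "norm (c n) * real n powr (- s) \<le> norm (c n) * (real n powr (- 2) * real (p + 1) powr (2 - s))"
          by (intro mult_left_mono) auto
        then show "norm (c n * npow n s) \<le> norm (c n) * real n powr (- 2) * real (p + 1) powr (2 - s)"
          by (simp add: norm_mult mult_ac)
      qed
      also have "real (p + 1) powr (2 - s) = real (p + 1) powr 2 * real (p + 1) powr (- s)"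
        by (subst powr_add[symmetric]) simp
      finally show ?case by (simp add: mult.assoc)
    qed
  qed
  then show ?thesis unfolding has_prime_coeff_def by blast
qed

lemma of_nat_powr_eq_npow: "of_nat n powr (- complex_of_real s) = npow n s" if "n \<ge> 1"
  using powr_of_real[of "real n" "- s"] by simp

text \<open>After subtraction of their constant terms, F - a 1 and exp L - 1 both have expansions
  from n = 2 on. They differ by the constant 1 - a 1, so their coefficients at p agree.\<close>

lemma euler_product_prime_coeff:
  assumes F: "has_dirichlet_series F a" and E: "has_euler_product F b" and p: "prime p"
  shows "a p = b p"
proof -
  have p2: "p \<ge> 2" using p prime_ge_2_nat by blast
  have A: "has_prime_coeff p (\<lambda>s. F (of_real s) - a 1) (a p)"
  proof (rule has_prime_coeff_dirichlet_series[OF _ _ p2])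
    fix s :: real
    assume "s \<ge> 2"
    then have "((\<lambda>n. a n * of_nat n powr (- of_real s)) has_sum F (of_real s)) {1..}"
      using F by (auto simp: has_dirichlet_series_def)
    from has_sum_Diff[OF this has_sum_finite[of "{1}"]]
    have "((\<lambda>n. a n * of_nat n powr (- of_real s)) has_sum (F (of_real s) - a 1)) ({1..} - {1})" by simp
    moreover have "{1..} - {1::nat} = {2..}" by auto
    ultimately show "((\<lambda>n. a n * npow n s) has_sum (F (of_real s) - a 1)) {2..}"
      by (subst has_sum_cong[where g = "\<lambda>n. a n * of_nat n powr (- of_real s)"])
         (auto simp: of_nat_powr_eq_npow)
  next
    have "(\<lambda>n. norm (a n * of_nat n powr (- complex_of_real 2))) summable_on {1..}"
      using F unfolding has_dirichlet_series_def by (metis Re_complex_of_real one_less_numeral_iff semiring_norm(76))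
    then have "(\<lambda>n. norm (a n * of_nat n powr (- complex_of_real 2))) summable_on {2..}"
      by (rule summable_on_subset_banach) auto
    moreover have "norm (a n * of_nat n powr (- complex_of_real 2)) = norm (a n) * real n powr (- 2)"
      if "n \<ge> 1" for n
      unfolding of_nat_powr_eq_npow[OF that] by (simp add: norm_mult)
    ultimately show "(\<lambda>n. norm (a n) * real n powr (- 2)) summable_on {2..}"
      by (subst (asm) summable_on_cong[where g = "\<lambda>n. norm (a n) * real n powr (- 2)"]) auto
  qed
  define I where "I = {q::nat. prime q} \<times> {1::nat..}"
  \<comment> \<open>A prime power determines its base and exponent, so reindexing by
    \<open>h\<close> turns the double series into an ordinary Dirichlet series.\<close>
  define h where "h = (\<lambda>(q::nat, k::nat). q ^ k)"
  have inj: "inj_on h I"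
  proof (rule inj_onI, clarify)
    fix q k r m
    assume "(q, k) \<in> I" "(r, m) \<in> I" "h (q, k) = h (r, m)"
    then have "prime q" "prime r" "q ^ k = r ^ m" "k > 0" "m > 0"
      unfolding I_def h_def by auto
    then show "q = r \<and> k = m" using prime_power_inj'[of q r k m] by blast
  qed
  have sub: "h ` I \<subseteq> {2..}"
  proof -
    have "2 \<le> q ^ k" if "prime q" "k \<ge> 1" for q k :: nat
      using that prime_ge_2_nat[of q] self_le_power[of q k] by linarith
    then show ?thesis by (auto simp: I_def h_def)
  qed
  \<comment> \<open>Away from prime powers the values of \<open>b\<close> are unconstrained, hence
    the default 0.\<close>
  define c where "c n = (if n \<in> h ` I then b n else 0)" for n
  define L where "L s = infsum (\<lambda>(q, k). b (q ^ k) * of_nat q powr (- (of_nat k * complex_of_real s))) I" for s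
  have npow_term: "b (q ^ k) * of_nat q powr (- (of_nat k * complex_of_real s)) = b (q ^ k) * npow (q ^ k) s"
    if "prime q" for q k s
  proof -
    have "of_nat q powr (- (of_nat k * complex_of_real s)) = of_nat q powr (of_real (- (real k * s)))" by simp
    also have "\<dots> = of_real (real q powr (- (real k * s)))"
      using powr_of_real[of "real q" "- (real k * s)"] by simp
    also have "real q powr (- (real k * s)) = real (q ^ k) powr (- s)"
      using prime_gt_0_nat[OF that] by (simp add: powr_powr flip: powr_realpow)
    finally show ?thesis by simp
  qed
  have summ: "(\<lambda>(q, k). norm (b (q ^ k) * npow (q ^ k) s)) summable_on I" if "s \<ge> 2" for s
  proof -
    have "Re (complex_of_real s) > 1" using that by simp
    then have "(\<lambda>(q, k). norm (b (q ^ k) * of_nat q powr (- (of_nat k * complex_of_real s)))) summable_on I"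
      using E unfolding has_euler_product_def I_def by blast
    then show ?thesis
      by (subst (asm) summable_on_cong[where g = "\<lambda>(q, k). norm (b (q ^ k) * npow (q ^ k) s)"])
         (auto simp: I_def npow_term simp del: of_nat_power)
  qed
  have "has_prime_coeff p L (c p)"
  proof (rule has_prime_coeff_dirichlet_series[OF _ _ p2])
    fix s :: real
    assume s: "s \<ge> 2"
    have L: "L s = infsum (\<lambda>(q, k). b (q ^ k) * npow (q ^ k) s) I"
      unfolding L_def by (rule infsum_cong) (auto simp: I_def npow_term simp del: of_nat_power)
    have "(\<lambda>(q, k). b (q ^ k) * npow (q ^ k) s) summable_on I"
      by (rule abs_summable_summable) (use summ[OF s] in \<open>simp add: case_prod_unfold\<close>)
    then have "((\<lambda>(q, k). b (q ^ k) * npow (q ^ k) s) has_sum L s) I"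
      unfolding L by (rule has_sum_infsum)
    then have "((\<lambda>n. b n * npow n s) \<circ> h has_sum L s) I"
      by (simp add: o_def h_def case_prod_unfold)
    then have "((\<lambda>n. b n * npow n s) has_sum L s) (h ` I)"
      using has_sum_reindex[OF inj] by blast
    then show "((\<lambda>n. c n * npow n s) has_sum L s) {2..}"
      by (subst has_sum_cong_neutral[where T = "h ` I" and g = "\<lambda>n. b n * npow n s"])
         (use sub in \<open>auto simp: c_def\<close>)
  next
    have "(\<lambda>n. norm (b n) * real n powr (- 2)) \<circ> h summable_on I"
      using summ[of 2] by (simp add: o_def h_def case_prod_unfold norm_mult)
    then have "(\<lambda>n. norm (b n) * real n powr (- 2)) summable_on (h ` I)"
      using summable_on_reindex[OF inj] by blast
    then show "(\<lambda>n. norm (c n) * real n powr (- 2)) summable_on {2..}"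
      by (subst summable_on_cong_neutral[where T = "h ` I" and g = "\<lambda>n. norm (b n) * real n powr (- 2)"])
         (use sub in \<open>auto simp: c_def\<close>)
  qed
  moreover have "c p = b p"
  proof -
    have "(p, 1) \<in> I" using p by (simp add: I_def)
    then have "p \<in> h ` I" by (force simp: h_def)
    then show ?thesis by (simp add: c_def)
  qed
  ultimately have B: "has_prime_coeff p (\<lambda>s. exp (L s) - 1) (b p)"
    using has_prime_coeff_exp[OF p] by simp
  have FL: "F (of_real s) = exp (L s)" if "s \<ge> 2" for s
  proof -
    have "Re (complex_of_real s) > 1" using that by simp
    then show ?thesis using E unfolding has_euler_product_def L_def I_def by blast
  qed
  have "has_prime_coeff p (\<lambda>s. (F (of_real s) - a 1) + (- 1) * (exp (L s) - 1)) (a p + (- 1) * b p)"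
    by (intro has_prime_coeff_add has_prime_coeff_cmult A B)
  \<comment> \<open>F = exp L is applied for s >= 2 only; an O-statement at infinity does not see
    the rest.\<close>
  then have "has_prime_coeff p (\<lambda>_. 1 - a 1) (a p + (- 1) * b p)"
    unfolding has_prime_coeff_def
  proof (elim exE conjE, intro exI conjI)
    fix d
    assume "(\<lambda>s. (F (of_real s) - a 1) + (- 1) * (exp (L s) - 1) - (\<Sum>n\<in>{2..p}. d n * npow n s)) \<in> O(npow (p + 1))"
    moreover have "\<forall>\<^sub>F s in at_top. (F (of_real s) - a 1) + (- 1) * (exp (L s) - 1) - (\<Sum>n\<in>{2..p}. d n * npow n s)
        = 1 - a 1 - (\<Sum>n\<in>{2..p}. d n * npow n s)"
      using eventually_ge_at_top[of 2] by eventually_elim (simp add: FL)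
    ultimately show "(\<lambda>s. 1 - a 1 - (\<Sum>n\<in>{2..p}. d n * npow n s)) \<in> O(npow (p + 1))"
      using landau_o.big.in_cong by fast
  qed
  from has_prime_coeff_const[OF this p2] show ?thesis by simp
qed

section \<open>Orthogonality and the local integral\<close>

lemma finite_primes_le: "finite {p. prime p \<and> real p \<le> x}"
proof (rule finite_subset)
  show "{p. prime p \<and> real p \<le> x} \<subseteq> {..nat \<lfloor>x\<rfloor>}" by (auto simp: le_nat_floor)
qed simp

text \<open>Expanding the square gives a Hermitian form in y whose entries are the sums in the
  orthogonality condition, and in the limit its matrix is diagonal. Off-diagonal sums are complex,
  so the limit is taken in the complex numbers and its real part only at the end.\<close>

lemma tendsto_orthogonal_form:
  fixes a :: "'n::finite \<Rightarrow> nat \<Rightarrow> complex" and y :: "complex ^ 'n" and m :: "'n \<Rightarrow> 'n \<Rightarrow> real"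
  assumes off: "\<And>i j. i \<noteq> j \<Longrightarrow> m i j = 0"
    and asymp: "\<And>i j. (\<lambda>x::real. (\<Sum>p | prime p \<and> real p \<le> x. a i p * cnj (a j p) / of_nat p)
                    - of_real (m i j * ln (ln x))) \<in> o[at_top](\<lambda>x. of_real (ln (ln x)))"
  shows "((\<lambda>x. (\<Sum>p | prime p \<and> real p \<le> x. (norm (\<Sum>j\<in>UNIV. cnj (y $ j) * a j p))\<^sup>2 / real p) / ln (ln x))
            \<longlongrightarrow> (\<Sum>j\<in>UNIV. (norm (y $ j))\<^sup>2 * m j j)) at_top"
proof -
  define G where "G i j x = (\<Sum>p | prime p \<and> real p \<le> x. a i p * cnj (a j p) / of_nat p)" for i j and x :: real
  define W where "W x = (\<Sum>p | prime p \<and> real p \<le> x. (norm (\<Sum>j\<in>UNIV. cnj (y $ j) * a j p))\<^sup>2 / real p)" for x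
  have ll: "\<forall>\<^sub>F x in at_top. ln (ln x) \<noteq> (0::real)"
  proof -
    have "filterlim (\<lambda>x::real. ln (ln x)) at_top at_top"
      by (rule filterlim_compose[OF ln_at_top ln_at_top])
    then have "\<forall>\<^sub>F x in at_top. ln (ln x) > (0::real)" by (simp add: filterlim_at_top_dense)
    then show ?thesis by eventually_elim simp
  qed
  have lim: "((\<lambda>x. G i j x / of_real (ln (ln x))) \<longlongrightarrow> of_real (m i j)) at_top" for i j
  proof -
    have "((\<lambda>x. (G i j x - of_real (m i j * ln (ln x))) / of_real (ln (ln x)) + of_real (m i j)) \<longlongrightarrow> 0 + of_real (m i j)) at_top"
      by (intro tendsto_add tendsto_const) (use smalloD_tendsto[OF asymp[of i j]] in \<open>simp add: G_def\<close>)
    then have "((\<lambda>x. (G i j x - of_real (m i j * ln (ln x))) / of_real (ln (ln x)) + of_real (m i j)) \<longlongrightarrow> of_real (m i j)) at_top"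
      by simp
    then show ?thesis
    proof (rule Lim_transform_eventually)
      show "\<forall>\<^sub>F x in at_top. (G i j x - of_real (m i j * ln (ln x))) / of_real (ln (ln x)) + of_real (m i j)
          = G i j x / of_real (ln (ln x))"
        using ll by eventually_elim (simp add: field_simps)
    qed
  qed
  have W: "complex_of_real (W x) = (\<Sum>i\<in>UNIV. \<Sum>j\<in>UNIV. cnj (y $ i) * y $ j * G i j x)" for x
  proof -
    have "complex_of_real ((norm (\<Sum>j\<in>UNIV. cnj (y $ j) * a j p))\<^sup>2 / real p)
        = (\<Sum>i\<in>UNIV. \<Sum>j\<in>UNIV. cnj (y $ i) * y $ j * (a i p * cnj (a j p) / of_nat p))" for p
    proof -
      have "complex_of_real ((norm (\<Sum>j\<in>UNIV. cnj (y $ j) * a j p))\<^sup>2)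
          = (\<Sum>i\<in>UNIV. cnj (y $ i) * a i p) * (\<Sum>j\<in>UNIV. y $ j * cnj (a j p))"
        unfolding complex_norm_square by simp
      also have "\<dots> = (\<Sum>i\<in>UNIV. \<Sum>j\<in>UNIV. (cnj (y $ i) * a i p) * (y $ j * cnj (a j p)))"
        by (rule sum_product)
      finally show ?thesis
        by (simp add: sum_divide_distrib mult_ac del: of_real_power)
    qed
    then have "complex_of_real (W x) = (\<Sum>p | prime p \<and> real p \<le> x.
        \<Sum>i\<in>UNIV. \<Sum>j\<in>UNIV. cnj (y $ i) * y $ j * (a i p * cnj (a j p) / of_nat p))"
      unfolding W_def of_real_sum by simp
    also have "\<dots> = (\<Sum>i\<in>UNIV. \<Sum>j\<in>UNIV. \<Sum>p | prime p \<and> real p \<le> x.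
        cnj (y $ i) * y $ j * (a i p * cnj (a j p) / of_nat p))"
      by (subst sum.swap, rule sum.cong[OF refl], rule sum.swap)
    finally show ?thesis by (simp only: G_def sum_distrib_left)
  qed
  have "((\<lambda>x. \<Sum>i\<in>UNIV. \<Sum>j\<in>UNIV. cnj (y $ i) * y $ j * (G i j x / of_real (ln (ln x))))
      \<longlongrightarrow> (\<Sum>i\<in>UNIV. \<Sum>j\<in>UNIV. cnj (y $ i) * y $ j * of_real (m i j))) at_top"
    by (intro tendsto_intros lim)
  moreover have "(\<Sum>i\<in>UNIV. \<Sum>j\<in>UNIV. cnj (y $ i) * y $ j * (G i j x / of_real (ln (ln x))))
      = of_real (W x / ln (ln x))" for x
    unfolding of_real_divide W by (simp only: sum_divide_distrib times_divide_eq_right)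
  moreover have "(\<Sum>i\<in>UNIV. \<Sum>j\<in>UNIV. cnj (y $ i) * y $ j * of_real (m i j))
      = of_real (\<Sum>j\<in>UNIV. (norm (y $ j))\<^sup>2 * m j j)"
  proof -
    have "(\<Sum>j\<in>UNIV. cnj (y $ i) * y $ j * of_real (m i j)) = of_real ((norm (y $ i))\<^sup>2 * m i i)" for i
    proof -
      have "(\<Sum>j\<in>UNIV. cnj (y $ i) * y $ j * of_real (m i j))
          = (\<Sum>j\<in>UNIV. if j = i then cnj (y $ i) * y $ i * of_real (m i i) else 0)"
        by (intro sum.cong) (auto simp: off)
      also have "\<dots> = cnj (y $ i) * y $ i * of_real (m i i)" by (subst sum.delta) auto
      also have "\<dots> = of_real ((norm (y $ i))\<^sup>2 * m i i)"
        by (simp add: complex_norm_square mult_ac del: of_real_power)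
      finally show ?thesis .
    qed
    then show ?thesis by simp
  qed
  ultimately have "((\<lambda>x. complex_of_real (W x / ln (ln x))) \<longlongrightarrow> of_real (\<Sum>j\<in>UNIV. (norm (y $ j))\<^sup>2 * m j j)) at_top"
    by simp
  from tendsto_Re[OF this] show ?thesis by (simp only: Re_complex_of_real W_def)
qed

text \<open>\<delta> can be chosen before y: there are finitely many indices, so the least diagonal
  entry \<mu> is positive and bounds the limiting form below by \<mu> |y|^2 for every y.\<close>

lemma orthogonal_coeffs_infinite_primes:
  fixes a :: "'n::finite \<Rightarrow> nat \<Rightarrow> complex"
  assumes "orthogonal_coeffs a"
  shows "\<exists>\<delta>>0. \<forall>y :: complex ^ 'n. y \<noteq> 0 \<longrightarrow>
           infinite {p. prime p \<and> \<delta> * norm y \<le> norm (\<Sum>j\<in>UNIV. cnj (y $ j) * a j p)}"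
proof -
  obtain m :: "'n \<Rightarrow> 'n \<Rightarrow> real" where m: "\<And>i. m i i > 0" "\<And>i j. i \<noteq> j \<Longrightarrow> m i j = 0"
    and asymp: "\<And>i j. (\<lambda>x::real. (\<Sum>p | prime p \<and> real p \<le> x. a i p * cnj (a j p) / of_nat p)
                    - of_real (m i j * ln (ln x))) \<in> o[at_top](\<lambda>x. of_real (ln (ln x)))"
    using assms unfolding orthogonal_coeffs_def by blast
  define \<mu> where "\<mu> = Min (range (\<lambda>i. m i i))"
  have "\<mu> \<in> range (\<lambda>i. m i i)" unfolding \<mu>_def by (rule Min_in) auto
  then have \<mu>: "\<mu> > 0" using m(1) by auto
  have \<mu>_le: "\<mu> \<le> m i i" for i by (simp add: \<mu>_def)
  \<comment> \<open>The bound for the sum of 1/p has constant 2 e. With this \<delta>, failure at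
    almost all primes would allow at most (\<mu>/2) |y|^2 ln ln x asymptotically, half of what
    orthogonality forces.\<close>
  define \<delta> where "\<delta> = sqrt (\<mu> / (4 * exp 1))"
  have \<delta>: "\<delta> > 0" "2 * exp 1 * \<delta>\<^sup>2 = \<mu> / 2" using \<mu> by (simp_all add: \<delta>_def)
  have "infinite {p. prime p \<and> \<delta> * norm y \<le> norm (\<Sum>j\<in>UNIV. cnj (y $ j) * a j p)}"
    (is "infinite ?T") if y: "y \<noteq> 0" for y :: "complex ^ 'n"
  proof
    assume fin: "finite ?T"
    define v where "v p = norm (\<Sum>j\<in>UNIV. cnj (y $ j) * a j p)" for p
    define W where "W x = (\<Sum>p | prime p \<and> real p \<le> x. (v p)\<^sup>2 / real p)" for x
    \<comment> \<open>The finitely many primes in \<open>?T\<close> add only a constant, negligible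
      against ln ln x.\<close>
    define H where "H = (\<Sum>p\<in>?T. (v p)\<^sup>2 / real p)"
    have W: "W x \<le> H + \<delta>\<^sup>2 * (norm y)\<^sup>2 * (2 * exp 1 * (ln 2 + ln (ln x)))" if x: "x \<ge> exp 1" for x
    proof -
      let ?P = "{p. prime p \<and> real p \<le> x}"
      have "W x \<le> (\<Sum>p\<in>?P. (if p \<in> ?T then (v p)\<^sup>2 / real p else 0) + \<delta>\<^sup>2 * (norm y)\<^sup>2 * (1 / real p))"
        unfolding W_def
      proof (rule sum_mono)
        fix p assume p: "p \<in> ?P"
        show "(v p)\<^sup>2 / real p \<le> (if p \<in> ?T then (v p)\<^sup>2 / real p else 0) + \<delta>\<^sup>2 * (norm y)\<^sup>2 * (1 / real p)"
        proof (cases "p \<in> ?T")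
          case False
          then have "v p \<le> \<delta> * norm y" using p by (simp add: v_def)
          then have "(v p)\<^sup>2 \<le> (\<delta> * norm y)\<^sup>2" by (intro power_mono) (simp_all add: v_def)
          then have "(v p)\<^sup>2 / real p \<le> (\<delta> * norm y)\<^sup>2 / real p" by (intro divide_right_mono) auto
          then show ?thesis by (simp add: power_mult_distrib if_not_P[OF False] del: mem_Collect_eq)
        qed simp
      qed
      also have "\<dots> = (\<Sum>p\<in>?P. if p \<in> ?T then (v p)\<^sup>2 / real p else 0) + \<delta>\<^sup>2 * (norm y)\<^sup>2 * (\<Sum>p\<in>?P. 1 / real p)"
        by (simp only: sum.distrib sum_distrib_left)
      also have "\<dots> \<le> H + \<delta>\<^sup>2 * (norm y)\<^sup>2 * (2 * exp 1 * (ln 2 + ln (ln x)))"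
      proof (intro add_mono mult_left_mono sum_inverse_primes_le[OF x])
        have "(\<Sum>p\<in>?P. if p \<in> ?T then (v p)\<^sup>2 / real p else 0) = (\<Sum>p\<in>?P \<inter> ?T. (v p)\<^sup>2 / real p)"
          by (rule sum.inter_restrict[OF finite_primes_le, symmetric])
        also have "\<dots> \<le> H" unfolding H_def by (rule sum_mono2[OF fin]) auto
        finally show "(\<Sum>p\<in>?P. if p \<in> ?T then (v p)\<^sup>2 / real p else 0) \<le> H" .
      qed simp
      finally show ?thesis .
    qed
    have ll: "filterlim (\<lambda>x::real. ln (ln x)) at_top at_top"
      by (rule filterlim_compose[OF ln_at_top ln_at_top])
    define M where "M = (\<Sum>j\<in>UNIV. (norm (y $ j))\<^sup>2 * m j j)"
    have L1: "((\<lambda>x. W x / ln (ln x)) \<longlongrightarrow> M) at_top"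
      unfolding W_def v_def M_def by (rule tendsto_orthogonal_form[OF m(2) asymp])
    define Q where "Q = \<delta>\<^sup>2 * (norm y)\<^sup>2 * (2 * exp 1)"
    have L2: "((\<lambda>x. (H + Q * ln 2) / ln (ln x) + Q) \<longlongrightarrow> 0 + Q) at_top"
      by (intro tendsto_add tendsto_const tendsto_divide_0[OF tendsto_const] filterlim_at_top_imp_at_infinity ll)
    have "\<forall>\<^sub>F x in at_top. W x / ln (ln x) \<le> (H + Q * ln 2) / ln (ln x) + Q"
      using filterlim_at_top_dense[THEN iffD1, OF ll, rule_format, of 0] eventually_ge_at_top[of "exp 1"]
    proof eventually_elim
      case (elim x)
      have "W x \<le> H + Q * ln 2 + Q * ln (ln x)"
        using W[OF elim(2)] by (simp add: Q_def algebra_simps)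
      then have "W x / ln (ln x) \<le> (H + Q * ln 2 + Q * ln (ln x)) / ln (ln x)"
        using elim(1) by (intro divide_right_mono) auto
      then show ?case using elim(1) by (simp add: add_divide_distrib)
    qed
    from tendsto_le[OF _ L2 L1 this] have "M \<le> Q" by simp
    moreover have "\<mu> * (norm y)\<^sup>2 \<le> M"
    proof -
      have "(norm y)\<^sup>2 = (\<Sum>j\<in>UNIV. (norm (y $ j))\<^sup>2)"
        by (simp add: norm_vec_def L2_set_def sum_nonneg)
      then have "\<mu> * (norm y)\<^sup>2 = (\<Sum>j\<in>UNIV. (norm (y $ j))\<^sup>2 * \<mu>)" by (simp add: sum_distrib_left mult.commute)
      also have "\<dots> \<le> M" unfolding M_def by (intro sum_mono mult_left_mono \<mu>_le) auto
      finally show ?thesis .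
    qed
    moreover have "Q = (2 * exp 1 * \<delta>\<^sup>2) * (norm y)\<^sup>2" by (simp add: Q_def)
    ultimately have "\<mu> * (norm y)\<^sup>2 \<le> \<mu> / 2 * (norm y)\<^sup>2" unfolding \<delta>(2) by linarith
    then show False using \<mu> y by simp
  qed
  then show ?thesis using \<delta>(1) by blast
qed

section \<open>Power series of the local factors and the choice of p\<close>

text \<open>The operator x d/dx is applied three times to the geometric series, matching the three
  derivatives of the phase that must be controlled.\<close>

lemma summable_cube_geometric:
  fixes r :: real
  assumes "0 \<le> r" "r < 1"
  shows "summable (\<lambda>n. real n ^ 3 * r ^ n)"
proof -
  have S0: "summable (\<lambda>n. (\<lambda>_. 1) n * x ^ n)" if "norm x < 1" for x :: complex
    using that by (simp add: summable_geometric)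
  have S1: "summable (\<lambda>n. of_nat n * 1 * x ^ n)" if "norm x < 1" for x :: complex
    using powser_euler_operator(1)[OF S0 that] by simp
  have S2: "summable (\<lambda>n. of_nat n * (of_nat n * 1) * x ^ n)" if "norm x < 1" for x :: complex
    using powser_euler_operator(1)[OF S1 that] by simp
  have "summable (\<lambda>n. of_nat n * (of_nat n * (of_nat n * 1)) * complex_of_real r ^ n)"
    using powser_euler_operator(1)[where K = 1, OF S2, of "of_real r"] assms by simp
  also have "(\<lambda>n. of_nat n * (of_nat n * (of_nat n * 1)) * complex_of_real r ^ n)
      = (\<lambda>n. of_real (real n ^ 3 * r ^ n))"
    by (simp add: power3_eq_cube mult.assoc)
  finally show ?thesis by (auto dest: summable_Re)
qed

text \<open>The height 2 pi t / ln p turns p^(-i height) into exp(-2 pi i t), so the unit interval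
  is one full period.\<close>

lemma local_factor_power:
  assumes "p \<ge> 2"
  shows "of_nat p powr (- (of_nat k * Complex \<sigma> (2 * pi * t / ln (real p))))
           = of_real (real p powr (- (real k * \<sigma>))) * cis (- (2 * pi * t)) ^ k"
proof -
  have lnp: "ln (real p) > 0" using assms by simp
  have "of_nat p powr (- (of_nat k * Complex \<sigma> (2 * pi * t / ln (real p))))
      = exp (- (of_nat k * Complex \<sigma> (2 * pi * t / ln (real p))) * of_real (ln (real p)))"
    using assms by (simp add: powr_def Ln_of_nat)
  also have "- (of_nat k * Complex \<sigma> (2 * pi * t / ln (real p))) * of_real (ln (real p))
      = of_real (- (real k * \<sigma>) * ln (real p)) + \<i> * of_real (real k * (- (2 * pi * t)))"
    using lnp by (simp add: complex_eq_iff)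
  also have "exp \<dots> = of_real (exp (- (real k * \<sigma>) * ln (real p))) * cis (real k * (- (2 * pi * t)))"
    by (simp only: exp_add cis_conv_exp exp_of_real)
  also have "exp (- (real k * \<sigma>) * ln (real p)) = real p powr (- (real k * \<sigma>))"
    using assms by (simp add: powr_def)
  also have "cis (real k * (- (2 * pi * t))) = cis (- (2 * pi * t)) ^ k"
    by (rule Complex.DeMoivre[symmetric])
  finally show ?thesis .
qed

text \<open>The radius p^(\<sigma>-\<theta>) exceeds 1, which is what later permits termwise
  differentiation on the circle. \<open>d 0 = 0\<close> bridges the sum from k = 1 and the power
  series from k = 0.\<close>

lemma log_local_factor_eq_powser:
  assumes p: "p \<ge> 2" and "\<theta> < \<sigma>"
    and b: "\<And>k. k \<ge> 1 \<Longrightarrow> norm (b (p ^ k)) \<le> C * real p powr (real k * \<theta>)"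
  defines "d k \<equiv> (if k = 0 then 0 else b (p ^ k) * of_real (real p powr (- (real k * \<sigma>))))"
  shows "norm (d k) \<le> \<bar>C\<bar> * (real p powr (\<theta> - \<sigma>)) ^ k"
    and "norm x < real p powr (\<sigma> - \<theta>) \<Longrightarrow> summable (\<lambda>k. norm (d k * x ^ k))"
    and "log_local_factor b p (Complex \<sigma> (2 * pi * t / ln (real p))) = (\<Sum>k. d k * cis (- (2 * pi * t)) ^ k)"
proof -
  define q where "q = real p powr (\<theta> - \<sigma>)"
  have q: "q > 0" using p by (simp add: q_def)
  have d: "norm (d k) \<le> \<bar>C\<bar> * q ^ k" for k
  proof (cases "k = 0")
    case False
    have "norm (d k) = norm (b (p ^ k)) * real p powr (- (real k * \<sigma>))"
      using False by (simp add: d_def norm_mult)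
    also have "\<dots> \<le> (\<bar>C\<bar> * real p powr (real k * \<theta>)) * real p powr (- (real k * \<sigma>))"
    proof (rule mult_right_mono)
      have "norm (b (p ^ k)) \<le> C * real p powr (real k * \<theta>)" using b[of k] False by simp
      also have "\<dots> \<le> \<bar>C\<bar> * real p powr (real k * \<theta>)" by (rule mult_right_mono) auto
      finally show "norm (b (p ^ k)) \<le> \<bar>C\<bar> * real p powr (real k * \<theta>)" .
    qed simp
    also have "\<dots> = \<bar>C\<bar> * real p powr (real k * (\<theta> - \<sigma>))"
      by (simp add: powr_add[symmetric] algebra_simps)
    also have "real p powr (real k * (\<theta> - \<sigma>)) = q ^ k"
      using p by (simp add: q_def powr_powr mult.commute flip: powr_realpow)
    finally show ?thesis .
  qed (simp add: d_def)
  then show "norm (d k) \<le> \<bar>C\<bar> * (real p powr (\<theta> - \<sigma>)) ^ k" by (simp add: q_def)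
  have S: "summable (\<lambda>k. norm (d k * x ^ k))" if x: "norm x < real p powr (\<sigma> - \<theta>)" for x
  proof (rule summable_comparison_test)
    have "q * norm x < q * real p powr (\<sigma> - \<theta>)" using x q by (rule mult_strict_left_mono)
    also have "\<dots> = 1" using p by (simp add: q_def flip: powr_add)
    finally show "summable (\<lambda>k. \<bar>C\<bar> * (q * norm x) ^ k)"
      using q by (intro summable_mult summable_geometric) simp
    have "norm (d k) * norm x ^ k \<le> (\<bar>C\<bar> * q ^ k) * norm x ^ k" for k
      by (rule mult_right_mono[OF d]) simp
    then show "\<exists>N. \<forall>k\<ge>N. norm (norm (d k * x ^ k)) \<le> \<bar>C\<bar> * (q * norm x) ^ k"
      by (simp add: norm_mult norm_power power_mult_distrib mult_ac)
  qed
  then show "norm x < real p powr (\<sigma> - \<theta>) \<Longrightarrow> summable (\<lambda>k. norm (d k * x ^ k))" .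
  define w where "w = cis (- (2 * pi * t))"
  have "1 < real p powr (\<sigma> - \<theta>)" using p assms(2) by simp
  then have Sw: "summable (\<lambda>k. norm (d k * w ^ k))" by (intro S) (simp add: w_def)
  have "((\<lambda>k. d k * w ^ k) has_sum (\<Sum>k. d k * w ^ k)) UNIV"
    by (rule norm_summable_imp_has_sum[OF Sw summable_sums[OF summable_norm_cancel[OF Sw]]])
  then have "((\<lambda>k. d k * w ^ k) has_sum (\<Sum>k. d k * w ^ k)) {1..}"
    by (subst has_sum_cong_neutral[where T = UNIV and g = "\<lambda>k. d k * w ^ k"]) (auto simp: d_def)
  then have "infsum (\<lambda>k. d k * w ^ k) {1..} = (\<Sum>k. d k * w ^ k)" by (rule infsumI)
  moreover have "log_local_factor b p (Complex \<sigma> (2 * pi * t / ln (real p))) = infsum (\<lambda>k. d k * w ^ k) {1..}"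
    unfolding log_local_factor_def local_factor_power[OF p]
    by (intro infsum_cong) (simp add: d_def w_def)
  ultimately show "log_local_factor b p (Complex \<sigma> (2 * pi * t / ln (real p))) = (\<Sum>k. d k * cis (- (2 * pi * t)) ^ k)"
    by (simp add: w_def)
qed

text \<open>With q = p^(\<theta>-\<sigma>), the weighted terms k >= 2 are at most a constant times
  |y| q^2, and |d 1| >= \<delta> |y| p^(-\<sigma>). The quotient is controlled by p^(2 \<theta> -
  1), so the smallness condition on p involves neither \<sigma> nor y.\<close>

lemma local_integral_bound:
  fixes b :: "'n::finite \<Rightarrow> nat \<Rightarrow> complex" and C :: "'n \<Rightarrow> real" and y :: "complex ^ 'n"
  defines "S \<equiv> \<Sum>k. real (k + 2) ^ 3 * (2 powr (- 1 / 2)) ^ (k + 2)"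
  assumes p: "p \<ge> 2" and \<sigma>: "\<sigma> \<ge> 1" and \<theta>: "\<theta> < 1 / 2"
    and b: "\<And>j k. k \<ge> 1 \<Longrightarrow> norm (b j (p ^ k)) \<le> C j * real p powr (real k * \<theta>)"
    and \<delta>: "\<delta> > 0" and y: "y \<noteq> 0"
    and low: "\<delta> * norm y \<le> norm (\<Sum>j\<in>UNIV. cnj (y $ j) * b j p)"
    and small: "(\<Sum>j\<in>UNIV. \<bar>C j\<bar>) * (2 * S) * real p powr (2 * \<theta> - 1) \<le> \<delta> / 4"
  shows "norm (local_integral b p \<sigma> y)
           \<le> (16 * pi ^ 3 + 1) * (1 + 16 * pi ^ 3 * pi / 2) / sqrt (\<delta> * norm y) * real p powr (\<sigma> / 2)"
proof -
  define D where "D = (\<Sum>j\<in>UNIV. \<bar>C j\<bar>)"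
  have D: "D \<ge> 0" by (simp add: D_def sum_nonneg)
  define q where "q = real p powr (\<theta> - \<sigma>)"
  \<comment> \<open>r bounds q for all p >= 2 and \<sigma> >= 1, because \<theta> - \<sigma> < -1/2.
    This makes \<open>S\<close> a numerical constant.\<close>
  define r :: real where "r = 2 powr (- 1 / 2)"
  have q0: "q > 0" using p by (simp add: q_def)
  have "r ^ 2 = 2 powr (- 1 / 2 + - 1 / 2)"
    unfolding r_def power2_eq_square by (rule powr_add[symmetric])
  then have r: "0 < r" "r < 1" "2 * r ^ 2 = 1"
    by (auto simp: r_def powr_less_one powr_minus_divide)
  have qr: "q \<le> r"
  proof -
    have "q \<le> real p powr (- 1 / 2)" unfolding q_def using p \<sigma> \<theta> by (intro powr_mono) auto
    also have "\<dots> \<le> r" unfolding r_def using p by (intro powr_mono2') auto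
    finally show ?thesis .
  qed
  define e where "e j k = (if k = 0 then 0 else b j (p ^ k) * of_real (real p powr (- (real k * \<sigma>))))" for j k
  define d where "d k = (\<Sum>j\<in>UNIV. cnj (y $ j) * e j k)" for k
  have \<theta>\<sigma>: "\<theta> < \<sigma>" using \<theta> \<sigma> by simp
  note e = log_local_factor_eq_powser[OF p \<theta>\<sigma> b, folded e_def]
  have d_le: "norm (d k) \<le> norm y * D * q ^ k" for k
  proof -
    have "norm (d k) \<le> (\<Sum>j\<in>UNIV. norm y * (\<bar>C j\<bar> * q ^ k))"
      unfolding d_def
    proof (rule sum_norm_le)
      fix j
      show "norm (cnj (y $ j) * e j k) \<le> norm y * (\<bar>C j\<bar> * q ^ k)"
        unfolding norm_mult complex_mod_cnj q_def
        by (intro mult_mono e(1) Finite_Cartesian_Product.norm_nth_le) auto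
    qed
    also have "\<dots> = norm y * D * q ^ k" by (simp add: D_def sum_distrib_left sum_distrib_right mult.assoc)
    finally show ?thesis .
  qed
  have K: "1 < real p powr (\<sigma> - \<theta>)" using p \<theta>\<sigma> by simp
  have e_sum: "summable (\<lambda>k. e j k * x ^ k)" if "norm x < real p powr (\<sigma> - \<theta>)" for j x
    by (rule summable_norm_cancel[OF e(2)[OF _ that]])
  have d_eq: "d k * x ^ k = (\<Sum>j\<in>UNIV. cnj (y $ j) * (e j k * x ^ k))" for k x
    by (simp add: d_def sum_distrib_right mult.assoc)
  have d_sum: "summable (\<lambda>k. d k * x ^ k)" if "norm x < real p powr (\<sigma> - \<theta>)" for x
    unfolding d_eq by (intro summable_sum summable_mult e_sum that)
  have series: "(\<Sum>j\<in>UNIV. Re (cnj (y $ j) * log_local_factor (b j) p (Complex \<sigma> (2 * pi * t / ln (real p)))))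
      = Re (\<Sum>k. d k * cis (- (2 * pi * t)) ^ k)" for t
  proof -
    let ?w = "cis (- (2 * pi * t))"
    have w: "norm ?w < real p powr (\<sigma> - \<theta>)" using K by simp
    have "(\<Sum>k. d k * ?w ^ k) = (\<Sum>j\<in>UNIV. \<Sum>k. cnj (y $ j) * (e j k * ?w ^ k))"
      unfolding d_eq by (intro suminf_sum summable_mult e_sum w)
    also have "\<dots> = (\<Sum>j\<in>UNIV. cnj (y $ j) * (\<Sum>k. e j k * ?w ^ k))"
      by (intro sum.cong refl suminf_mult e_sum w)
    finally show ?thesis using e(3) by simp
  qed
  define R where "R = norm (d 1)"
  have R: "\<delta> * norm y * real p powr (- \<sigma>) \<le> R"
  proof -
    have "d 1 = (\<Sum>j\<in>UNIV. cnj (y $ j) * b j p) * of_real (real p powr (- \<sigma>))"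
      by (simp add: d_def e_def sum_distrib_right mult.assoc)
    then have "R = norm (\<Sum>j\<in>UNIV. cnj (y $ j) * b j p) * real p powr (- \<sigma>)"
      by (simp add: R_def norm_mult)
    then show ?thesis using low by (simp add: mult_right_mono)
  qed
  have pos: "0 < \<delta> * norm y * real p powr (- \<sigma>)" using \<delta> y p by simp
  have tail_le: "real (k + 2) ^ 3 * norm (d (k + 2)) \<le> norm y * D * q ^ 2 * 2 * (real (k + 2) ^ 3 * r ^ (k + 2))" for k
  proof -
    \<comment> \<open>The factor q^2 is kept, since it carries the decay in p, and the remaining q^k
      is traded for r^k = 2 r^(k+2).\<close>
    have "q ^ k \<le> r ^ k" using q0 qr by (intro power_mono) auto
    also have "r ^ k = r ^ k * (2 * r ^ 2)" using r(3) by simp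
    also have "\<dots> = 2 * r ^ (k + 2)" by (simp only: power_add mult_ac)
    finally have "q ^ 2 * q ^ k \<le> q ^ 2 * (2 * r ^ (k + 2))"
      by (rule mult_left_mono) simp
    moreover have "q ^ (k + 2) = q ^ 2 * q ^ k" by (simp only: power_add mult_ac)
    ultimately have "q ^ (k + 2) \<le> q ^ 2 * (2 * r ^ (k + 2))" by (simp only:)
    then have "norm y * D * q ^ (k + 2) \<le> norm y * D * (q ^ 2 * (2 * r ^ (k + 2)))"
      using D by (intro mult_left_mono) auto
    with d_le[of "k + 2"] have "norm (d (k + 2)) \<le> norm y * D * (q ^ 2 * (2 * r ^ (k + 2)))" by (rule order_trans)
    then have "real (k + 2) ^ 3 * norm (d (k + 2)) \<le> real (k + 2) ^ 3 * (norm y * D * (q ^ 2 * (2 * r ^ (k + 2))))"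
      by (rule mult_left_mono) simp
    then show ?thesis by (simp only: mult_ac)
  qed
  have Ssum: "summable (\<lambda>k. real (k + 2) ^ 3 * r ^ (k + 2))"
    using summable_ignore_initial_segment[OF summable_cube_geometric[of r], of 2] r by simp
  have tail1: "summable (\<lambda>k. real (k + 2) ^ 3 * norm (d (k + 2)))"
    by (rule summable_comparison_test'[OF summable_mult[OF Ssum, of "norm y * D * q ^ 2 * 2"], of 0])
       (use tail_le in simp)
  have "(\<Sum>k. real (k + 2) ^ 3 * norm (d (k + 2))) \<le> (\<Sum>k. norm y * D * q ^ 2 * 2 * (real (k + 2) ^ 3 * r ^ (k + 2)))"
    by (intro suminf_le tail_le tail1 summable_mult Ssum)
  also have "\<dots> = norm y * D * q ^ 2 * 2 * S"
    unfolding S_def r_def[symmetric] by (rule suminf_mult[OF Ssum])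
  also have "\<dots> = q ^ 2 * (norm y * D * (2 * S))" by simp
  also have "\<dots> \<le> (real p powr (- \<sigma>) * real p powr (2 * \<theta> - 1)) * (norm y * D * (2 * S))"
  proof (rule mult_right_mono)
    have "q ^ 2 = real p powr (2 * (\<theta> - \<sigma>))" using p by (simp add: q_def powr_power)
    \<comment> \<open>Here \<sigma> >= 1 is used: 2 \<theta> - 2 \<sigma> <= -\<sigma> + (2 \<theta>
      - 1).\<close>
    also have "\<dots> \<le> real p powr (- \<sigma> + (2 * \<theta> - 1))" using p \<sigma> by (intro powr_mono) auto
    finally show "q ^ 2 \<le> real p powr (- \<sigma>) * real p powr (2 * \<theta> - 1)" by (simp only: powr_add)
    have "S \<ge> 0" unfolding S_def r_def[symmetric] by (rule suminf_nonneg[OF Ssum]) (use r in simp)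
    then show "0 \<le> norm y * D * (2 * S)" using D by simp
  qed
  also have "\<dots> = norm y * real p powr (- \<sigma>) * (D * (2 * S) * real p powr (2 * \<theta> - 1))"
    by (simp only: mult_ac)
  also have "\<dots> \<le> norm y * real p powr (- \<sigma>) * (\<delta> / 4)"
    using small by (intro mult_left_mono) (simp_all add: D_def)
  also have "\<dots> \<le> R / 4" using R by (simp add: mult_ac)
  finally have tail2: "(\<Sum>k. real (k + 2) ^ 3 * norm (d (k + 2))) \<le> norm (d 1) / 4" by (simp add: R_def)
  define A where "A = (16 * pi ^ 3 + 1) * (1 + 16 * pi ^ 3 * pi / 2)"
  have A: "A \<ge> 0" by (simp add: A_def)
  have "norm (local_integral b p \<sigma> y) \<le> A / sqrt R"
    unfolding local_integral_def series R_def A_def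
    by (rule trig_series_integral_bound[OF K d_sum _ _ tail1 tail2])
       (use R pos in \<open>auto simp: d_def e_def R_def\<close>)
  also have "\<dots> \<le> A / sqrt (\<delta> * norm y * real p powr (- \<sigma>))"
    using R pos A by (intro divide_left_mono mult_pos_pos) auto
  also have "sqrt (\<delta> * norm y * real p powr (- \<sigma>)) = sqrt (\<delta> * norm y) / real p powr (\<sigma> / 2)"
  proof -
    have "(1 / real p powr (\<sigma> / 2))\<^sup>2 = real p powr (- \<sigma>)"
      by (simp add: power2_eq_square powr_minus_divide flip: powr_add)
    then have "sqrt (real p powr (- \<sigma>)) = 1 / real p powr (\<sigma> / 2)"
      by (rule real_sqrt_unique) simp
    then show ?thesis by (simp only: real_sqrt_mult times_divide_eq_right mult_1_right)
  qed
  finally show ?thesis using p by (simp add: A_def)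
qed

lemma norm_vector_scalar_mult:
  fixes c :: complex and y :: "complex ^ 'n"
  shows "norm (c *s y) = norm c * norm y"
  by (simp add: norm_vec_def norm_mult L2_set_right_distrib)

theorem theorem9:
  fixes F :: "'n::finite \<Rightarrow> complex \<Rightarrow> complex"
    and a b :: "'n \<Rightarrow> nat \<Rightarrow> complex"
  assumes "\<And>j. has_dirichlet_series (F j) (a j)"
    and "\<And>j. has_euler_product (F j) (b j)"
    and "orthogonal_coeffs a"
  shows "\<exists>A>0. \<forall>y :: complex ^ 'n. y \<noteq> 0 \<longrightarrow>
           infinite {p. prime p \<and>
             (\<forall>\<sigma>\<ge>1. \<forall>c. c \<noteq> 0 \<longrightarrow>
                norm (local_integral b p \<sigma> (c *s y))
                  \<le> A / sqrt (norm (c *s y)) * real p powr (\<sigma> / 2))}"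
proof -
  have ab: "a j p = b j p" if "prime p" for j p
    by (rule euler_product_prime_coeff[OF assms(1,2) that])
  obtain \<delta> where \<delta>: "\<delta> > 0" and inf: "\<And>y :: complex ^ 'n. y \<noteq> 0 \<Longrightarrow>
      infinite {p. prime p \<and> \<delta> * norm y \<le> norm (\<Sum>j\<in>UNIV. cnj (y $ j) * a j p)}"
    using orthogonal_coeffs_infinite_primes[OF assms(3)] by blast
  have "\<exists>\<theta> C. \<theta> < 1 / 2 \<and> (\<forall>p k. prime p \<longrightarrow> k \<ge> 1 \<longrightarrow>
      norm (b j (p ^ k)) \<le> C * real p powr (real k * \<theta>))" for j
    using assms(2)[of j] unfolding has_euler_product_def by blast
  then obtain \<theta>' C where \<theta>': "\<And>j. \<theta>' j < (1 / 2 :: real)"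
    and C: "\<And>j p k. prime p \<Longrightarrow> k \<ge> 1 \<Longrightarrow> norm (b j (p ^ k)) \<le> C j * real p powr (real k * \<theta>' j)"
    by metis
  \<comment> \<open>One exponent for all j. Enlarging the exponents preserves the bounds once the
    constants are replaced by their absolute values.\<close>
  define \<theta> where "\<theta> = Max (range \<theta>')"
  have "\<theta> \<in> range \<theta>'" unfolding \<theta>_def by (rule Max_in) auto
  then have \<theta>: "\<theta> < 1 / 2" using \<theta>' by auto
  have b: "norm (b j (p ^ k)) \<le> \<bar>C j\<bar> * real p powr (real k * \<theta>)" if "prime p" "k \<ge> 1" for j p k
  proof -
    have "norm (b j (p ^ k)) \<le> C j * real p powr (real k * \<theta>' j)" by (rule C[OF that])
    also have "\<dots> \<le> \<bar>C j\<bar> * real p powr (real k * \<theta>)"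
    proof (rule mult_mono)
      have "\<theta>' j \<le> \<theta>" by (simp add: \<theta>_def)
      then show "real p powr (real k * \<theta>' j) \<le> real p powr (real k * \<theta>)"
        using prime_ge_1_nat[OF that(1)] by (intro powr_mono mult_left_mono) auto
    qed auto
    finally show ?thesis .
  qed
  define S :: real where "S = (\<Sum>k. real (k + 2) ^ 3 * (2 powr (- 1 / 2)) ^ (k + 2))"
  define D where "D = (\<Sum>j\<in>UNIV. \<bar>\<bar>C j\<bar>\<bar>) * (2 * S)"
  have "((\<lambda>p. D * real p powr (2 * \<theta> - 1)) \<longlongrightarrow> D * 0) sequentially"
    by (intro tendsto_mult tendsto_const tendsto_neg_powr filterlim_real_sequentially) (use \<theta> in auto)
  then have "\<forall>\<^sub>F p in sequentially. D * real p powr (2 * \<theta> - 1) < \<delta> / 4"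
    by (rule order_tendstoD) (use \<delta> in auto)
  \<comment> \<open>\<open>P\<close> is fixed before y, so discarding the primes below it costs each
    line only finitely many.\<close>
  then obtain P where P: "\<And>p. p \<ge> P \<Longrightarrow> D * real p powr (2 * \<theta> - 1) < \<delta> / 4"
    unfolding eventually_sequentially by blast
  define K where "K = (16 * pi ^ 3 + 1) * (1 + 16 * pi ^ 3 * pi / 2)"
  have K: "K > 0" unfolding K_def by (intro mult_pos_pos add_nonneg_pos add_pos_nonneg) auto
  show ?thesis
  proof (intro exI[of _ "K / sqrt \<delta>"] conjI allI impI)
    show "K / sqrt \<delta> > 0" using K \<delta> by simp
    fix y :: "complex ^ 'n"
    assume y: "y \<noteq> 0"
    let ?T = "{p. prime p \<and> \<delta> * norm y \<le> norm (\<Sum>j\<in>UNIV. cnj (y $ j) * a j p)}"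
    have "norm (local_integral b p \<sigma> (c *s y)) \<le> K / sqrt \<delta> / sqrt (norm (c *s y)) * real p powr (\<sigma> / 2)"
      if p: "p \<in> ?T - {..<P}" and \<sigma>: "\<sigma> \<ge> 1" and c: "c \<noteq> 0" for p \<sigma> c
    proof -
      have pp: "prime p" "p \<ge> P" using p by auto
      have cy: "c *s y \<noteq> 0" using c y by simp
      \<comment> \<open>Both sides of the lower bound scale by |c|, so a prime found for y serves
        its whole complex line.\<close>
      have "\<delta> * norm (c *s y) = norm c * (\<delta> * norm y)" by (simp add: norm_vector_scalar_mult)
      also have "\<dots> \<le> norm c * norm (\<Sum>j\<in>UNIV. cnj (y $ j) * a j p)"
        using p by (intro mult_left_mono) auto
      also have "\<dots> = norm (cnj c * (\<Sum>j\<in>UNIV. cnj (y $ j) * a j p))" by (simp add: norm_mult)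
      also have "cnj c * (\<Sum>j\<in>UNIV. cnj (y $ j) * a j p) = (\<Sum>j\<in>UNIV. cnj ((c *s y) $ j) * b j p)"
        by (simp add: sum_distrib_left mult.assoc ab[OF pp(1)])
      finally have low: "\<delta> * norm (c *s y) \<le> norm (\<Sum>j\<in>UNIV. cnj ((c *s y) $ j) * b j p)" .
      have "norm (local_integral b p \<sigma> (c *s y)) \<le> K / sqrt (\<delta> * norm (c *s y)) * real p powr (\<sigma> / 2)"
        unfolding K_def
        by (rule local_integral_bound[OF prime_ge_2_nat[OF pp(1)] \<sigma> \<theta> b[OF pp(1)] \<delta> cy low])
           (use P[OF pp(2)] in \<open>simp_all add: D_def S_def\<close>)
      then show ?thesis by (simp add: real_sqrt_mult)
    qed
    then have "?T - {..<P} \<subseteq> {p. prime p \<and> (\<forall>\<sigma>\<ge>1. \<forall>c. c \<noteq> 0 \<longrightarrow>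
        norm (local_integral b p \<sigma> (c *s y)) \<le> K / sqrt \<delta> / sqrt (norm (c *s y)) * real p powr (\<sigma> / 2))}"
      by blast
    moreover have "infinite (?T - {..<P})" using inf[OF y] by (rule Diff_infinite_finite[rotated]) simp
    ultimately show "infinite {p. prime p \<and> (\<forall>\<sigma>\<ge>1. \<forall>c. c \<noteq> 0 \<longrightarrow>
        norm (local_integral b p \<sigma> (c *s y)) \<le> K / sqrt \<delta> / sqrt (norm (c *s y)) * real p powr (\<sigma> / 2))}"
      by (rule infinite_super)
  qed
qed

end
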